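(* Let $M$ be a totally umbilical STCR lightlike submanifold of an indefinite Kähler manifold $\bar M$, where $\dim(TM)=m$, $\dim(Rad(TM))=r$, $\dim(tr(TM))=n$. Let $\{\xi_1,\dots,\xi_r\}$ be a (local) basis of $Rad(TM)$ and $\{W_1,\dots,W_{n-r}\}$ a (local) basis of $S(TM^\perp)$. Then $M$ is minimal if and only if, for all $j\in\{1,\dots,n-r\}$ and $k\in\{1,\dots,r\}$, $$\operatorname{trace}A_{W_j}|_{D_0\perp\bar J(S)}=\operatorname{trace}A^*_{\xi_k}|_{D_0\perp\bar J(S)}=0.$$
   Context: Indefinite Kähler manifold $(\bar M,\bar J,\bar g)$: a semi-Riemannian manifold of constant index $q$, $0<q<\dim\bar M$, with an almost complex structure $\bar J$ ($\bar J^2=-I$) satisfying $\bar g(\bar JX,\bar JY)=\bar g(X,Y)$ and $\bar\nabla\bar J=0$, where $\bar\nabla$ is the Levi-Civita connection of $\bar g$. Lightlike submanifold: a submanifold $M$ of dimension $m$ of $\bar M$ (of dimension $m+n$), with induced metric $g$, such that $Rad(TM)=TM\cap TM^\perp$ has constant rank $r$, $1\le r\le m$. One fixes non-degenerate complements: a screen distribution $S(TM)$ with $TM=S(TM)\perp Rad(TM)$ and a screen transversal bundle $S(TM^\perp)$ with $TM^\perp=S(TM^\perp)\perp Rad(TM)$. The lightlike transversal bundle $ltr(TM)$ is a rank $r$ complement of $Rad(TM)$ in the orthogonal complement of $S(TM)\perp S(TM^\perp)$ in $T\bar M|_M$, locally spanned by $N_1,\dots,N_r$ with $\bar g(\xi_i,N_j)=\delta_{ij}$,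 $\bar g(N_i,N_j)=0$ for a local basis $\{\xi_i\}$ of $Rad(TM)$. Put $tr(TM)=ltr(TM)\perp S(TM^\perp)$; then $T\bar M|_M=TM\oplus tr(TM)$. STCR (screen transversal Cauchy Riemann) lightlike submanifold: a real lightlike submanifold $M$ of $\bar M$ such that (A) there are subbundles $D_1,D_2$ of $Rad(TM)$ with $Rad(TM)=D_1\oplus D_2$, $\bar J(D_1)\subset S(TM)$, $\bar J(D_2)\subset S(TM^\perp)$; (B) there are subbundles $D_0,D'$ of $S(TM)$ with $S(TM)=\{\bar JD_1\oplus D'\}\perp D_0$, $\bar J(D_0)=D_0$, $\bar J(D')=L_1\perp S$, where $D_0$ is non-degenerate and $L_1$, $S$ are vector subbundles of $ltr(TM)$ and $S(TM^\perp)$ respectively. Moreover $ltr(TM)=L_1\oplus L_2$ with $\bar J(L_1)\subset S(TM)$, $\bar J(L_2)\subset S(TM^\perp)$, and $S(TM^\perp)=\{\bar J(D_2)\oplus\bar J(L_2)\}\perp S$. Gauss–Weingarten formulas (for $X,Y\in\Gamma(TM)$, $W\in\Gamma(S(TM^\perp))$, $\xi\in\Gamma(Rad(TM))$): $\bar\nabla_XY=\nabla_XY+h(X,Y)$, $h=h^l+h^s$, with $\nabla_XY\in\Gamma(TM)$, $h^l(X,Y)\in\Gamma(ltr(TM))$, $h^s(X,Y)\in\Gamma(S(TM^\perp))$; $\bar\nabla_XW=-A_WX+D^l(X,W)+\nabla^s_XW$ with $A_WX\in\Gamma(TM)$, $D^l(X,W)\in\Gamma(ltr(TM))$, $\nabla^s_XW\in\Gamma(S(TM^\perp))$;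 $\nabla_X\xi=-A^*_\xi X+\nabla^{*t}_X\xi$ with $A^*_\xi X\in\Gamma(S(TM))$, $\nabla^{*t}_X\xi\in\Gamma(Rad(TM))$. For an operator $A$ on $TM$, $\operatorname{trace}A|_{D_0\perp\bar J(S)}=\sum_i\varepsilon_i\,g(Ae_i,e_i)$, with $\{e_i\}$ a local orthonormal basis of $D_0\perp\bar J(S)$ and $\varepsilon_i=g(e_i,e_i)=\pm1$. $M$ is totally umbilical if there is a smooth transversal vector field $H\in\Gamma(tr(TM))$ with $h(X,Y)=g(X,Y)H$ for all $X,Y\in\Gamma(TM)$. $M$ is minimal if (i) $h^s=0$ on $Rad(TM)$ and (ii) $\operatorname{trace}h=0$, the trace being taken with respect to $g$ restricted to $S(TM)$.
   Formalization: It is additionally assumed that $D_0\perp\bar J(S)$ is nonzero unless $S(TM)=0$; otherwise the trace conditions are vacuous and the claim fails, e.g. for the null cone minus the origin in $\mathbb{C}^2$ with the neutral metric, which is totally umbilical but not minimal. *)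

theory Defs
  imports "HOL-Analysis.Analysis" "HOL-Library.Set_Algebras"
begin

section \<open>Smooth manifolds\<close>

primrec Ck_on :: "nat \<Rightarrow> ('v::euclidean_space \<Rightarrow> 'w::real_normed_vector) \<Rightarrow> 'v set \<Rightarrow> bool" where
  "Ck_on 0 f X \<longleftrightarrow> continuous_on X f"
| "Ck_on (Suc k) f X \<longleftrightarrow>
     (\<forall>x\<in>X. f differentiable (at x)) \<and> (\<forall>v. Ck_on k (\<lambda>x. frechet_derivative f (at x) v) X)"

text \<open>Only used for open \<open>X\<close>.\<close>

definition smooth_on :: "('v::euclidean_space \<Rightarrow> 'w::real_normed_vector) \<Rightarrow> 'v set \<Rightarrow> bool" where
  "smooth_on f X \<longleftrightarrow> (\<forall>k. Ck_on k f X)"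

text \<open>A chart is a pair of its domain and its coordinate map. The underlying set of a manifold is
  a whole type (Hausdorff and second countable by its type class), and its dimension is the
  dimension of the Euclidean space \<open>'v\<close> in which the charts take their values.\<close>

type_synonym ('p, 'v) chart = "'p set \<times> ('p \<Rightarrow> 'v)"

definition chart_inv :: "('p, 'v) chart \<Rightarrow> 'v \<Rightarrow> 'p" where
  "chart_inv c = inv_into (fst c) (snd c)"

definition smooth_atlas ::
  "('p::{t2_space,second_countable_topology}, 'v::euclidean_space) chart set \<Rightarrow> bool" where
  "smooth_atlas A \<longleftrightarrow>
     (\<Union>c\<in>A. fst c) = UNIV \<and>
     (\<forall>c\<in>A. open (fst c) \<and> open (snd c ` fst c) \<and>
        homeomorphism (fst c) (snd c ` fst c) (snd c) (chart_inv c)) \<and>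
     (\<forall>c\<in>A. \<forall>d\<in>A. smooth_on (snd d \<circ> chart_inv c) (snd c ` (fst c \<inter> fst d)))"

text \<open>Once and for all a chart around each point is selected. The tangent space at \<open>p\<close> is
  the Euclidean space \<open>'v\<close>, a tangent vector being given by its components in the selected
  chart \<open>chart_at A p\<close>. \<open>to_chart A d p\<close> gives the components of a tangent vector at \<open>p\<close> in another
  chart \<open>d\<close>, and \<open>from_chart A d p\<close> is its inverse.\<close>

definition chart_at :: "('p, 'v) chart set \<Rightarrow> 'p \<Rightarrow> ('p, 'v) chart" where
  "chart_at A p = (SOME c. c \<in> A \<and> p \<in> fst c)"

definition to_chart ::
  "('p, 'v::euclidean_space) chart set \<Rightarrow> ('p, 'v) chart \<Rightarrow> 'p \<Rightarrow> 'v \<Rightarrow> 'v" where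
  "to_chart A d p =
     frechet_derivative (snd d \<circ> chart_inv (chart_at A p)) (at (snd (chart_at A p) p))"

definition from_chart ::
  "('p, 'v::euclidean_space) chart set \<Rightarrow> ('p, 'v) chart \<Rightarrow> 'p \<Rightarrow> 'v \<Rightarrow> 'v" where
  "from_chart A d p = frechet_derivative (snd (chart_at A p) \<circ> chart_inv d) (at (snd d p))"

text \<open>In the following, \<open>B\<close> is an atlas of the domain and \<open>A\<close> one of the codomain of a
  map \<open>f\<close>.\<close>

definition smooth_map ::
  "('b::topological_space, 'c::euclidean_space) chart set \<Rightarrow>
   ('a::topological_space, 'e::euclidean_space) chart set \<Rightarrow> ('b \<Rightarrow> 'a) \<Rightarrow> bool" where
  "smooth_map B A f \<longleftrightarrow> continuous_on UNIV f \<and>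
     (\<forall>c\<in>B. \<forall>d\<in>A. smooth_on (snd d \<circ> f \<circ> chart_inv c) (snd c ` (fst c \<inter> f -` fst d)))"

definition tangent_map ::
  "('b, 'c::euclidean_space) chart set \<Rightarrow> ('a, 'e::euclidean_space) chart set \<Rightarrow>
   ('b \<Rightarrow> 'a) \<Rightarrow> 'b \<Rightarrow> 'c \<Rightarrow> 'e" where
  "tangent_map B A f p =
     frechet_derivative (snd (chart_at A (f p)) \<circ> f \<circ> chart_inv (chart_at B p))
       (at (snd (chart_at B p) p))"

text \<open>Smooth vector fields along \<open>f\<close>, that is, sections of the pullback of the tangent bundle of
  the codomain, over an open set \<open>U\<close> of the domain. For the identity map these are the
  ordinary vector fields on \<open>U\<close>.\<close>

definition smooth_field_along ::
  "('b, 'c::euclidean_space) chart set \<Rightarrow> ('a, 'e::euclidean_space) chart set \<Rightarrow>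
   ('b \<Rightarrow> 'a) \<Rightarrow> 'b set \<Rightarrow> ('b \<Rightarrow> 'e) \<Rightarrow> bool" where
  "smooth_field_along B A f U Y \<longleftrightarrow>
     (\<forall>c\<in>B. \<forall>d\<in>A.
        smooth_on (\<lambda>x. to_chart A d (f (chart_inv c x)) (Y (chart_inv c x)))
          (snd c ` (fst c \<inter> U \<inter> f -` fst d)))"


section \<open>Linear algebra of symmetric bilinear forms\<close>

definition nondegenerate_on :: "('v::real_vector \<Rightarrow> 'v \<Rightarrow> real) \<Rightarrow> 'v set \<Rightarrow> bool" where
  "nondegenerate_on b E \<longleftrightarrow> (\<forall>x\<in>E. (\<forall>y\<in>E. b x y = 0) \<longrightarrow> x = 0)"

definition form_index :: "('v::euclidean_space \<Rightarrow> 'v \<Rightarrow> real) \<Rightarrow> nat" where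
  "form_index b = Max {dim V | V. subspace V \<and> (\<forall>x\<in>V. x \<noteq> 0 \<longrightarrow> b x x < 0)}"

definition perp :: "('v \<Rightarrow> 'v \<Rightarrow> real) \<Rightarrow> 'v set \<Rightarrow> 'v set" where
  "perp b E = {v. \<forall>x\<in>E. b v x = 0}"

definition direct_sum :: "'v::real_vector set \<Rightarrow> 'v set \<Rightarrow> 'v set \<Rightarrow> bool" where
  "direct_sum E X Y \<longleftrightarrow> E = X + Y \<and> X \<inter> Y = {0}"

definition orth_sum ::
  "('v::real_vector \<Rightarrow> 'v \<Rightarrow> real) \<Rightarrow> 'v set \<Rightarrow> 'v set \<Rightarrow> 'v set \<Rightarrow> bool" where
  "orth_sum b E X Y \<longleftrightarrow> direct_sum E X Y \<and> (\<forall>x\<in>X. \<forall>y\<in>Y. b x y = 0)"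

definition proj_along :: "'v::real_vector set \<Rightarrow> 'v set \<Rightarrow> 'v \<Rightarrow> 'v" where
  "proj_along X Y z = (THE x. x \<in> X \<and> z - x \<in> Y)"

definition orthonormal_basis ::
  "('v::real_vector \<Rightarrow> 'v \<Rightarrow> real) \<Rightarrow> 'v set \<Rightarrow> 'v set \<Rightarrow> bool" where
  "orthonormal_basis b E K \<longleftrightarrow> finite K \<and> independent K \<and> span K = E \<and>
     pairwise (\<lambda>x y. b x y = 0) K \<and> (\<forall>e\<in>K. b e e = 1 \<or> b e e = -1)"

text \<open>The trace of a bilinear map \<open>F\<close> over \<open>E\<close>, with respect to a form \<open>b\<close> which is
  non-degenerate on \<open>E\<close>. The result does not depend on the chosen basis. The trace of an
  operator \<open>A\<close> is the trace of \<open>\<lambda>x y. b (A x) y\<close>.\<close>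

definition trace_on ::
  "('v::real_vector \<Rightarrow> 'v \<Rightarrow> real) \<Rightarrow> 'v set \<Rightarrow> ('v \<Rightarrow> 'v \<Rightarrow> 'w::real_vector) \<Rightarrow> 'w" where
  "trace_on b E F =
     (let K = (SOME K. orthonormal_basis b E K) in \<Sum>e\<in>K. b e e *\<^sub>R F e e)"


section \<open>Semi-Riemannian manifolds and the Levi-Civita connection\<close>

record ('a, 'e) semi_riem =
  atlas :: "('a, 'e) chart set"
  metric :: "'a \<Rightarrow> 'e \<Rightarrow> 'e \<Rightarrow> real"

definition metric_in_chart ::
  "('a, 'e::euclidean_space, 'z) semi_riem_scheme \<Rightarrow> ('a, 'e) chart \<Rightarrow> 'e \<Rightarrow> 'e \<Rightarrow> 'e \<Rightarrow> real" where
  "metric_in_chart Mb d x u v =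
     (let p = chart_inv d x in
      metric Mb p (from_chart (atlas Mb) d p u) (from_chart (atlas Mb) d p v))"

definition semi_riemannian ::
  "nat \<Rightarrow> ('a::{t2_space,second_countable_topology}, 'e::euclidean_space, 'z) semi_riem_scheme
     \<Rightarrow> bool" where
  "semi_riemannian q Mb \<longleftrightarrow>
     smooth_atlas (atlas Mb) \<and>
     (\<forall>p. bilinear (metric Mb p) \<and> (\<forall>u v. metric Mb p u v = metric Mb p v u) \<and>
        nondegenerate_on (metric Mb p) UNIV \<and> form_index (metric Mb p) = q) \<and>
     (\<forall>d\<in>atlas Mb. \<forall>u v. smooth_on (\<lambda>x. metric_in_chart Mb d x u v) (snd d ` fst d))"

text \<open>The coefficients of the Levi-Civita connection in a chart \<open>d\<close>, in the form
  \<open>christoffel Mb d x u v = \<nabla>_u v\<close> for vector fields \<open>u\<close>, \<open>v\<close> with constant components in \<open>d\<close>.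
  Such fields commute, so the second clause says that the connection is torsion-free, and the last
  one says that it is metric.\<close>

definition christoffel ::
  "('a, 'e::euclidean_space, 'z) semi_riem_scheme \<Rightarrow> ('a, 'e) chart \<Rightarrow> 'e \<Rightarrow> 'e \<Rightarrow> 'e \<Rightarrow> 'e" where
  "christoffel Mb d x = (THE \<Gamma>. bilinear \<Gamma> \<and>
     (\<forall>u v. \<Gamma> u v = \<Gamma> v u) \<and>
     (\<forall>u v w. frechet_derivative (\<lambda>y. metric_in_chart Mb d y v w) (at x) u =
        metric_in_chart Mb d x (\<Gamma> u v) w + metric_in_chart Mb d x v (\<Gamma> u w)))"

text \<open>The Levi-Civita connection for vector fields along a map \<open>f\<close>: the covariant derivative of
  \<open>Y\<close> in the direction of a tangent vector \<open>u\<close> of the domain of \<open>f\<close> at \<open>p\<close>, computed as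
  \<open>dY(u) + \<Gamma>(df u, Y)\<close> in the selected charts. For the identity map this is the usual Levi-Civita
  connection.\<close>

definition cov_along ::
  "('b, 'c::euclidean_space) chart set \<Rightarrow> ('a, 'e::euclidean_space, 'z) semi_riem_scheme \<Rightarrow>
   ('b \<Rightarrow> 'a) \<Rightarrow> 'b \<Rightarrow> 'c \<Rightarrow> ('b \<Rightarrow> 'e) \<Rightarrow> 'e" where
  "cov_along B Mb f p u Y =
     (let c = chart_at B p; d = chart_at (atlas Mb) (f p) in
      frechet_derivative
        (\<lambda>x. to_chart (atlas Mb) d (f (chart_inv c x)) (Y (chart_inv c x))) (at (snd c p)) u
      + christoffel Mb d (snd d (f p)) (tangent_map B (atlas Mb) f p u) (Y p))"


section \<open>Indefinite Kaehler manifolds\<close>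

record ('a, 'e) almost_hermitian = "('a, 'e) semi_riem" +
  cstr :: "'a \<Rightarrow> 'e \<Rightarrow> 'e"

definition indefinite_Kaehler ::
  "nat \<Rightarrow> ('a::{t2_space,second_countable_topology}, 'e::euclidean_space) almost_hermitian
     \<Rightarrow> bool" where
  "indefinite_Kaehler q Mb \<longleftrightarrow>
     semi_riemannian q Mb \<and> 0 < q \<and> q < DIM('e) \<and>
     (\<forall>p. linear (cstr Mb p) \<and> (\<forall>u. cstr Mb p (cstr Mb p u) = - u) \<and>
        (\<forall>u v. metric Mb p (cstr Mb p u) (cstr Mb p v) = metric Mb p u v)) \<and>
     (\<forall>d\<in>atlas Mb. \<forall>u.
        smooth_on (\<lambda>x. let p = chart_inv d x in
            to_chart (atlas Mb) d p (cstr Mb p (from_chart (atlas Mb) d p u))) (snd d ` fst d)) \<and>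
     (\<forall>U Y p u. open U \<and> p \<in> U \<and> smooth_field_along (atlas Mb) (atlas Mb) id U Y \<longrightarrow>
        cov_along (atlas Mb) Mb id p u (\<lambda>q. cstr Mb q (Y q)) =
        cstr Mb p (cov_along (atlas Mb) Mb id p u Y))"


section \<open>Submanifolds\<close>

text \<open>A submanifold is given by an injective immersion of a manifold (the type \<open>'b\<close>). Its
  tangent vectors are identified with their images under the differential, so that a vector bundle
  over the submanifold is a family of subspaces of the tangent spaces of the ambient manifold.\<close>

record ('b, 'c, 'a) submfd =
  satlas :: "('b, 'c) chart set"
  imm :: "'b \<Rightarrow> 'a"

definition dimm ::
  "('a, 'e::euclidean_space) almost_hermitian \<Rightarrow> ('b, 'c::euclidean_space, 'a, 'z) submfd_scheme
     \<Rightarrow> 'b \<Rightarrow> 'c \<Rightarrow> 'e" where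
  "dimm Mb M p = tangent_map (satlas M) (atlas Mb) (imm M) p"

definition submanifold ::
  "('a::{t2_space,second_countable_topology}, 'e::euclidean_space) almost_hermitian \<Rightarrow>
   ('b::{t2_space,second_countable_topology}, 'c::euclidean_space, 'a, 'z) submfd_scheme
     \<Rightarrow> bool" where
  "submanifold Mb M \<longleftrightarrow> smooth_atlas (satlas M) \<and>
     smooth_map (satlas M) (atlas Mb) (imm M) \<and> inj (imm M) \<and> (\<forall>p. inj (dimm Mb M p))"

definition met ::
  "('a, 'e) almost_hermitian \<Rightarrow> ('b, 'c, 'a, 'z) submfd_scheme \<Rightarrow> 'b \<Rightarrow> 'e \<Rightarrow> 'e \<Rightarrow> real" where
  "met Mb M p = metric Mb (imm M p)"

definition Jb ::
  "('a, 'e) almost_hermitian \<Rightarrow> ('b, 'c, 'a, 'z) submfd_scheme \<Rightarrow> 'b \<Rightarrow> 'e \<Rightarrow> 'e" where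
  "Jb Mb M p = cstr Mb (imm M p)"

definition TM ::
  "('a, 'e::euclidean_space) almost_hermitian \<Rightarrow> ('b, 'c::euclidean_space, 'a, 'z) submfd_scheme
     \<Rightarrow> 'b \<Rightarrow> 'e set" where
  "TM Mb M p = range (dimm Mb M p)"

definition TM_perp ::
  "('a, 'e::euclidean_space) almost_hermitian \<Rightarrow> ('b, 'c::euclidean_space, 'a, 'z) submfd_scheme
     \<Rightarrow> 'b \<Rightarrow> 'e set" where
  "TM_perp Mb M p = perp (met Mb M p) (TM Mb M p)"

definition Rad ::
  "('a, 'e::euclidean_space) almost_hermitian \<Rightarrow> ('b, 'c::euclidean_space, 'a, 'z) submfd_scheme
     \<Rightarrow> 'b \<Rightarrow> 'e set" where
  "Rad Mb M p = TM Mb M p \<inter> TM_perp Mb M p"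

definition sections ::
  "('a, 'e::euclidean_space) almost_hermitian \<Rightarrow>
   ('b::topological_space, 'c::euclidean_space, 'a, 'z) submfd_scheme \<Rightarrow> 'b set \<Rightarrow>
   ('b \<Rightarrow> 'e set) \<Rightarrow> ('b \<Rightarrow> 'e) set" where
  "sections Mb M U E =
     {Y. smooth_field_along (satlas M) (atlas Mb) (imm M) U Y \<and> (\<forall>p\<in>U. Y p \<in> E p)}"

definition local_frame ::
  "('a, 'e::euclidean_space) almost_hermitian \<Rightarrow>
   ('b::topological_space, 'c::euclidean_space, 'a, 'z) submfd_scheme \<Rightarrow> 'b set \<Rightarrow> nat \<Rightarrow>
   (nat \<Rightarrow> 'b \<Rightarrow> 'e) \<Rightarrow> ('b \<Rightarrow> 'e set) \<Rightarrow> bool" where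
  "local_frame Mb M U k e E \<longleftrightarrow> open U \<and> (\<forall>i<k. e i \<in> sections Mb M U E) \<and>
     (\<forall>p\<in>U. inj_on (\<lambda>i. e i p) {..<k} \<and> independent ((\<lambda>i. e i p) ` {..<k}) \<and>
        span ((\<lambda>i. e i p) ` {..<k}) = E p)"

definition vector_bundle ::
  "('a, 'e::euclidean_space) almost_hermitian \<Rightarrow>
   ('b::topological_space, 'c::euclidean_space, 'a, 'z) submfd_scheme \<Rightarrow> nat \<Rightarrow>
   ('b \<Rightarrow> 'e set) \<Rightarrow> bool" where
  "vector_bundle Mb M k E \<longleftrightarrow> (\<forall>p. \<exists>U e. p \<in> U \<and> local_frame Mb M U k e E)"

definition subbundle ::
  "('a, 'e::euclidean_space) almost_hermitian \<Rightarrow>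
   ('b::topological_space, 'c::euclidean_space, 'a, 'z) submfd_scheme \<Rightarrow>
   ('b \<Rightarrow> 'e set) \<Rightarrow> ('b \<Rightarrow> 'e set) \<Rightarrow> bool" where
  "subbundle Mb M E F \<longleftrightarrow> (\<exists>k. vector_bundle Mb M k E) \<and> (\<forall>p. E p \<subseteq> F p)"

definition nab_bar ::
  "('a, 'e::euclidean_space) almost_hermitian \<Rightarrow> ('b, 'c::euclidean_space, 'a, 'z) submfd_scheme
     \<Rightarrow> 'b \<Rightarrow> 'e \<Rightarrow> ('b \<Rightarrow> 'e) \<Rightarrow> 'e" where
  "nab_bar Mb M p x Y = cov_along (satlas M) Mb (imm M) p (inv (dimm Mb M p) x) Y"


section \<open>Lightlike submanifolds\<close>

text \<open>\<open>screen\<close>, \<open>screen_tr\<close> and \<open>ltr\<close> are $S(TM)$, $S(TM^\perp)$ and $ltr(TM)$.\<close>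

record ('b, 'c, 'a, 'e) lightlike = "('b, 'c, 'a) submfd" +
  screen :: "'b \<Rightarrow> 'e set"
  screen_tr :: "'b \<Rightarrow> 'e set"
  ltr :: "'b \<Rightarrow> 'e set"

definition lightlike_submanifold ::
  "nat \<Rightarrow> ('a::{t2_space,second_countable_topology}, 'e::euclidean_space) almost_hermitian \<Rightarrow>
   ('b::{t2_space,second_countable_topology}, 'c::euclidean_space, 'a, 'e, 'z) lightlike_scheme
     \<Rightarrow> bool" where
  "lightlike_submanifold r Mb M \<longleftrightarrow>
     submanifold Mb M \<and>
     1 \<le> r \<and> r \<le> DIM('c) \<and> (\<forall>p. dim (Rad Mb M p) = r) \<and>
     subbundle Mb M (screen M) (TM Mb M) \<and>
     subbundle Mb M (screen_tr M) (TM_perp Mb M) \<and>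
     vector_bundle Mb M r (ltr M) \<and>
     (\<forall>p. nondegenerate_on (met Mb M p) (screen M p) \<and>
          orth_sum (met Mb M p) (TM Mb M p) (screen M p) (Rad Mb M p) \<and>
          nondegenerate_on (met Mb M p) (screen_tr M p) \<and>
          orth_sum (met Mb M p) (TM_perp Mb M p) (screen_tr M p) (Rad Mb M p) \<and>
          direct_sum (perp (met Mb M p) (screen M p + screen_tr M p)) (Rad Mb M p) (ltr M p)) \<and>
     (\<forall>p. \<exists>U \<xi> N. p \<in> U \<and> local_frame Mb M U r \<xi> (Rad Mb M) \<and> local_frame Mb M U r N (ltr M) \<and>
        (\<forall>y\<in>U. \<forall>i<r. \<forall>j<r. met Mb M y (\<xi> i y) (N j y) = (if i = j then 1 else 0) \<and>
           met Mb M y (N i y) (N j y) = 0))"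

definition tr_bundle :: "('b, 'c, 'a, 'e::real_vector, 'z) lightlike_scheme \<Rightarrow> 'b \<Rightarrow> 'e set" where
  "tr_bundle M p = ltr M p + screen_tr M p"

text \<open>The Gauss and Weingarten formulas. The arguments are a point \<open>p\<close>, a tangent vector
  \<open>x\<close> of the submanifold at \<open>p\<close>, and a section near \<open>p\<close>: a tangent field \<open>Y\<close>, a section \<open>W\<close>
  of the screen transversal bundle, or a section \<open>\<xi>\<close> of the radical.\<close>

definition nab ::
  "('a, 'e::euclidean_space) almost_hermitian \<Rightarrow>
   ('b, 'c::euclidean_space, 'a, 'e, 'z) lightlike_scheme \<Rightarrow> 'b \<Rightarrow> 'e \<Rightarrow> ('b \<Rightarrow> 'e) \<Rightarrow> 'e" where
  "nab Mb M p x Y = proj_along (TM Mb M p) (tr_bundle M p) (nab_bar Mb M p x Y)"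

definition sff ::
  "('a, 'e::euclidean_space) almost_hermitian \<Rightarrow>
   ('b, 'c::euclidean_space, 'a, 'e, 'z) lightlike_scheme \<Rightarrow> 'b \<Rightarrow> 'e \<Rightarrow> ('b \<Rightarrow> 'e) \<Rightarrow> 'e" where
  "sff Mb M p x Y = proj_along (tr_bundle M p) (TM Mb M p) (nab_bar Mb M p x Y)"

definition sff_s ::
  "('a, 'e::euclidean_space) almost_hermitian \<Rightarrow>
   ('b, 'c::euclidean_space, 'a, 'e, 'z) lightlike_scheme \<Rightarrow> 'b \<Rightarrow> 'e \<Rightarrow> ('b \<Rightarrow> 'e) \<Rightarrow> 'e" where
  "sff_s Mb M p x Y = proj_along (screen_tr M p) (ltr M p) (sff Mb M p x Y)"

definition shape_W ::
  "('a, 'e::euclidean_space) almost_hermitian \<Rightarrow>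
   ('b, 'c::euclidean_space, 'a, 'e, 'z) lightlike_scheme \<Rightarrow> 'b \<Rightarrow> ('b \<Rightarrow> 'e) \<Rightarrow> 'e \<Rightarrow> 'e" where
  "shape_W Mb M p W x = - proj_along (TM Mb M p) (tr_bundle M p) (nab_bar Mb M p x W)"

definition shape_star ::
  "('a, 'e::euclidean_space) almost_hermitian \<Rightarrow>
   ('b, 'c::euclidean_space, 'a, 'e, 'z) lightlike_scheme \<Rightarrow> 'b \<Rightarrow> ('b \<Rightarrow> 'e) \<Rightarrow> 'e \<Rightarrow> 'e" where
  "shape_star Mb M p \<xi> x = - proj_along (screen M p) (Rad Mb M p) (nab Mb M p x \<xi>)"

text \<open>\<open>sff\<close> is tensorial, so it acts on tangent vectors through any local extension of the
  second argument.\<close>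

definition sff_vec ::
  "('a, 'e::euclidean_space) almost_hermitian \<Rightarrow>
   ('b::topological_space, 'c::euclidean_space, 'a, 'e, 'z) lightlike_scheme \<Rightarrow>
   'b \<Rightarrow> 'e \<Rightarrow> 'e \<Rightarrow> 'e" where
  "sff_vec Mb M p x y = sff Mb M p x
     (SOME Y. Y p = y \<and> (\<exists>U. open U \<and> p \<in> U \<and> Y \<in> sections Mb M U (TM Mb M)))"

definition totally_umbilical ::
  "('a, 'e::euclidean_space) almost_hermitian \<Rightarrow>
   ('b::topological_space, 'c::euclidean_space, 'a, 'e, 'z) lightlike_scheme \<Rightarrow> bool" where
  "totally_umbilical Mb M \<longleftrightarrow> (\<exists>H \<in> sections Mb M UNIV (tr_bundle M).
     \<forall>U X Y p. open U \<and> p \<in> U \<and> X \<in> sections Mb M U (TM Mb M) \<and> Y \<in> sections Mb M U (TM Mb M) \<longrightarrow>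
       sff Mb M p (X p) Y = met Mb M p (X p) (Y p) *\<^sub>R H p)"

definition minimal ::
  "('a, 'e::euclidean_space) almost_hermitian \<Rightarrow>
   ('b::topological_space, 'c::euclidean_space, 'a, 'e, 'z) lightlike_scheme \<Rightarrow> bool" where
  "minimal Mb M \<longleftrightarrow>
     (\<forall>U X Y p. open U \<and> p \<in> U \<and> X \<in> sections Mb M U (Rad Mb M) \<and> Y \<in> sections Mb M U (Rad Mb M) \<longrightarrow>
       sff_s Mb M p (X p) Y = 0) \<and>
     (\<forall>p. trace_on (met Mb M p) (screen M p) (sff_vec Mb M p) = 0)"


section \<open>STCR lightlike submanifolds\<close>

text \<open>\<open>D'\<close> and \<open>S_sub\<close> are $D'$ and $S$. The subbundles are allowed to have rank zero.\<close>

record ('b, 'c, 'a, 'e) stcr = "('b, 'c, 'a, 'e) lightlike" +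
  D0 :: "'b \<Rightarrow> 'e set"
  D1 :: "'b \<Rightarrow> 'e set"
  D2 :: "'b \<Rightarrow> 'e set"
  D' :: "'b \<Rightarrow> 'e set"
  L1 :: "'b \<Rightarrow> 'e set"
  L2 :: "'b \<Rightarrow> 'e set"
  S_sub :: "'b \<Rightarrow> 'e set"

definition STCR_lightlike ::
  "nat \<Rightarrow> ('a::{t2_space,second_countable_topology}, 'e::euclidean_space) almost_hermitian \<Rightarrow>
   ('b::{t2_space,second_countable_topology}, 'c::euclidean_space, 'a, 'e) stcr \<Rightarrow> bool" where
  "STCR_lightlike r Mb M \<longleftrightarrow>
     lightlike_submanifold r Mb M \<and>
     subbundle Mb M (D1 M) (Rad Mb M) \<and> subbundle Mb M (D2 M) (Rad Mb M) \<and>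
     subbundle Mb M (D0 M) (screen M) \<and> subbundle Mb M (D' M) (screen M) \<and>
     subbundle Mb M (L1 M) (ltr M) \<and> subbundle Mb M (L2 M) (ltr M) \<and>
     subbundle Mb M (S_sub M) (screen_tr M) \<and>
     (\<forall>p. let g = met Mb M p; J = Jb Mb M p in
        direct_sum (Rad Mb M p) (D1 M p) (D2 M p) \<and>
        J ` D1 M p \<subseteq> screen M p \<and> J ` D2 M p \<subseteq> screen_tr M p \<and>
        J ` D1 M p \<inter> D' M p = {0} \<and>
        orth_sum g (screen M p) (J ` D1 M p + D' M p) (D0 M p) \<and>
        J ` D0 M p = D0 M p \<and> orth_sum g (J ` D' M p) (L1 M p) (S_sub M p) \<and>
        nondegenerate_on g (D0 M p) \<and>
        direct_sum (ltr M p) (L1 M p) (L2 M p) \<and>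
        J ` L1 M p \<subseteq> screen M p \<and> J ` L2 M p \<subseteq> screen_tr M p \<and>
        J ` D2 M p \<inter> J ` L2 M p = {0} \<and>
        orth_sum g (screen_tr M p) (J ` D2 M p + J ` L2 M p) (S_sub M p))"

definition D0_JS ::
  "('a, 'e::euclidean_space) almost_hermitian \<Rightarrow>
   ('b, 'c::euclidean_space, 'a, 'e) stcr \<Rightarrow> 'b \<Rightarrow> 'e set" where
  "D0_JS Mb M p = D0 M p + Jb Mb M p ` S_sub M p"

definition trace_D0_JS ::
  "('a, 'e::euclidean_space) almost_hermitian \<Rightarrow>
   ('b, 'c::euclidean_space, 'a, 'e) stcr \<Rightarrow> 'b \<Rightarrow> ('e \<Rightarrow> 'e) \<Rightarrow> real" where
  "trace_D0_JS Mb M p A = trace_on (met Mb M p) (D0_JS Mb M p) (\<lambda>x y. met Mb M p (A x) y)"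

end

theory Submission
  imports Defs
begin

text \<open>Let \<open>H\<close> be the transversal field with \<open>h(X, Y) = g(X, Y) H\<close>. The trace of \<open>h\<close> over the screen
  is \<open>(dim S(TM)) H\<close>, while \<open>h\<^sup>s\<close> vanishes on the isotropic radical, so minimality means that
  \<open>H = 0\<close> wherever the screen is non-zero. Differentiating \<open>g(W, Y) = 0\<close> and \<open>g(\<xi>, Y) = 0\<close> for
  tangent fields \<open>Y\<close> gives \<open>g(A\<^sub>W X, Y) = g(X, Y) g(H, W)\<close> and \<open>g(A\<^sup>*\<^sub>\<xi> X, Y) = g(X, Y) g(H, \<xi>)\<close> on the
  screen, so the two kinds of traces are \<open>g(H, W)\<close> and \<open>g(H, \<xi>)\<close> times the dimension of
  \<open>D\<^sub>0 \<bottom> J(S)\<close>. A transversal vector orthogonal to the radical and to \<open>S(TM\<^sup>\<bottom>)\<close> is zero.\<close>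

section \<open>Smooth maps and charts\<close>

text \<open>The connection is given in coordinates: \<open>cov_along\<close> adds a
  \<open>christoffel\<close> term, itself a definite description, to a derivative of components in
  selected charts. The rule on which the argument rests, compatibility with the metric, therefore
  has to be earned: the Koszul formula shows that the description denotes something, and a product
  rule handles the varying metric coefficients. For two fields orthogonal on an open set,
  compatibility moves the derivative from one to the other, which expresses both shape operators
  through \<open>sff\<close>.

  The shape operators are paired with screen vectors only. The radical and tr(TM) are both
  orthogonal to the screen, so the components discarded by the projections do not contribute. This
  suffices because D0 + J(S) lies in the screen and is non-degenerate. The screen also contains
  J(D1) and J(L1), however: if D0 + J(S) is zero while the screen is not, both traces are empty sums
  and carry no information on \<open>H\<close>. The hypothesis \<open>trace_nonvacuous\<close>
  excludes exactly this case.\<close>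

lemma Ck_on_cong:
  assumes "open X" and "Ck_on k f X" and "\<And>x. x \<in> X \<Longrightarrow> f x = g x"
  shows "Ck_on k g X"
  using assms(2,3)
proof (induction k arbitrary: f g)
  case 0
  then show ?case by (simp cong: continuous_on_cong)
next
  case (Suc k)
  \<comment> \<open>Since \<open>X\<close> is open, \<open>f\<close> and \<open>g\<close> agree near
    each point of \<open>X\<close> and so have the same derivatives there.\<close>
  have der: "(g has_derivative D) (at x) \<longleftrightarrow> (f has_derivative D) (at x)" if "x \<in> X" for x D
    using has_derivative_transform_within_open[OF _ \<open>open X\<close> that, of f D UNIV g]
      has_derivative_transform_within_open[OF _ \<open>open X\<close> that, of g D UNIV f] Suc.prems(2)
    by metis
  have "frechet_derivative f (at x) = frechet_derivative g (at x)" if "x \<in> X" for x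
    using der[OF that] unfolding frechet_derivative_def by simp
  moreover have "g differentiable (at x)" if "x \<in> X" for x
    using der[OF that] Suc.prems(1) that by (auto simp: differentiable_def)
  ultimately show ?case
    using Suc.prems(1) Suc.IH[of "\<lambda>x. frechet_derivative f (at x) _" "\<lambda>x. frechet_derivative g (at x) _"]
    by auto
qed

lemma Ck_on_add_scaleR:
  assumes "open X"
  shows "Ck_on k f X \<Longrightarrow> Ck_on k g X \<Longrightarrow> Ck_on k (\<lambda>x. f x + c *\<^sub>R g x) X"
proof (induction k arbitrary: f g)
  case 0
  then show ?case by (auto intro!: continuous_intros)
next
  case (Suc k)
  have der: "((\<lambda>x. f x + c *\<^sub>R g x) has_derivative
      (\<lambda>v. frechet_derivative f (at x) v + c *\<^sub>R frechet_derivative g (at x) v)) (at x)"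
    if "x \<in> X" for x
    using Suc.prems that by (auto intro!: derivative_intros simp: frechet_derivative_works[symmetric])
  have "Ck_on k (\<lambda>x. frechet_derivative (\<lambda>x. f x + c *\<^sub>R g x) (at x) v) X" for v
  proof (rule Ck_on_cong[OF assms])
    show "Ck_on k (\<lambda>x. frechet_derivative f (at x) v + c *\<^sub>R frechet_derivative g (at x) v) X"
      using Suc by simp
  qed (simp flip: frechet_derivative_at[OF der])
  then show ?case
    using der by (auto simp: differentiable_def)
qed

lemma smooth_on_add_scaleR:
  "open X \<Longrightarrow> smooth_on f X \<Longrightarrow> smooth_on g X \<Longrightarrow> smooth_on (\<lambda>x. f x + c *\<^sub>R g x) X"
  unfolding smooth_on_def using Ck_on_add_scaleR by blast

lemma smooth_on_zero: "smooth_on (\<lambda>x. 0) X"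
proof -
  have "Ck_on k (\<lambda>x. 0) X" for k
    by (induction k) simp_all
  then show ?thesis
    unfolding smooth_on_def by blast
qed

lemma smooth_on_subset:
  assumes "smooth_on f X" "Y \<subseteq> X"
  shows "smooth_on f Y"
proof -
  have "Ck_on k f X \<Longrightarrow> Ck_on k f Y" for k
    using assms(2) by (induction k arbitrary: f) (auto intro: continuous_on_subset)
  then show ?thesis
    using assms(1) unfolding smooth_on_def by blast
qed

lemma smooth_on_cong:
  "open X \<Longrightarrow> smooth_on f X \<Longrightarrow> (\<And>x. x \<in> X \<Longrightarrow> f x = g x) \<Longrightarrow> smooth_on g X"
  unfolding smooth_on_def using Ck_on_cong by blast

lemma smooth_on_has_derivative:
  assumes "smooth_on f X" "x \<in> X"
  shows "(f has_derivative frechet_derivative f (at x)) (at x)"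
proof -
  have "Ck_on (Suc 0) f X"
    using assms(1) unfolding smooth_on_def by blast
  then show ?thesis
    using assms(2) by (simp add: frechet_derivative_works)
qed

text \<open>Chain rule for a map that is the identity near \<open>x\<close>. Applied to the two
  transition maps between charts, it makes \<open>to_chart\<close> and \<open>from_chart\<close>
  mutually inverse.\<close>

lemma frechet_derivative_of_comp:
  assumes "(f has_derivative frechet_derivative f (at x)) (at x)"
    and "(g has_derivative frechet_derivative g (at (f x))) (at (f x))"
    and "open X" "x \<in> X" and "\<And>y. y \<in> X \<Longrightarrow> g (f y) = y"
  shows "frechet_derivative g (at (f x)) (frechet_derivative f (at x) v) = v"
proof -
  have "((\<lambda>y. y) has_derivative (\<lambda>v. frechet_derivative g (at (f x)) (frechet_derivative f (at x) v)))
      (at x)"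
    by (rule has_derivative_transform_within_open[OF has_derivative_compose[OF assms(1,2)] assms(3-5)])
  from has_derivative_unique[OF this has_derivative_ident] show ?thesis
    by (rule fun_cong)
qed

section \<open>Components of tangent vectors in different charts\<close>

context
  fixes A :: "('a::{t2_space,second_countable_topology}, 'e::euclidean_space) chart set"
  assumes A: "smooth_atlas A"
begin

lemma chart_at_mem: "chart_at A p \<in> A" "p \<in> fst (chart_at A p)"
proof -
  have "\<exists>c. c \<in> A \<and> p \<in> fst c"
    using A unfolding smooth_atlas_def by blast
  from someI_ex[OF this] show "chart_at A p \<in> A" "p \<in> fst (chart_at A p)"
    by (auto simp: chart_at_def)
qed

lemma chart_inv_chart: "d \<in> A \<Longrightarrow> p \<in> fst d \<Longrightarrow> chart_inv d (snd d p) = p"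
  using A by (auto simp: smooth_atlas_def homeomorphism_def)

lemma open_chart_image:
  assumes "d \<in> A" "open V"
  shows "open (snd d ` (fst d \<inter> V))"
proof -
  have "homeomorphism (fst d) (snd d ` fst d) (snd d) (chart_inv d)" "open (snd d ` fst d)"
    using A assms by (auto simp: smooth_atlas_def)
  then show ?thesis
    using homeomorphism_imp_open_map[of "fst d" "snd d ` fst d" "snd d" "chart_inv d" "fst d \<inter> V"] assms(2)
    by (auto intro: openin_open_trans)
qed

lemma open_chart_domain: "d \<in> A \<Longrightarrow> open (fst d)"
  using A by (auto simp: smooth_atlas_def)

lemma transition_has_derivative:
  assumes "c \<in> A" "d \<in> A" "p \<in> fst c" "p \<in> fst d"
  shows "(snd d \<circ> chart_inv c has_derivative frechet_derivative (snd d \<circ> chart_inv c) (at (snd c p)))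
      (at (snd c p))"
  using assms A by (intro smooth_on_has_derivative[of _ "snd c ` (fst c \<inter> fst d)"]) (auto simp: smooth_atlas_def)

lemma transition_inverse:
  assumes "c \<in> A" "d \<in> A" "p \<in> fst c" "p \<in> fst d"
  shows "frechet_derivative (snd c \<circ> chart_inv d) (at (snd d p))
    (frechet_derivative (snd d \<circ> chart_inv c) (at (snd c p)) v) = v"
proof -
  have p: "(snd d \<circ> chart_inv c) (snd c p) = snd d p"
    using assms by (simp add: chart_inv_chart)
  show ?thesis
    using assms
    by (intro frechet_derivative_of_comp[OF transition_has_derivative[OF assms],
        of "snd c \<circ> chart_inv d" "snd c ` (fst c \<inter> fst d)" v, unfolded p])
      (auto simp: chart_inv_chart open_chart_image open_chart_domain intro: transition_has_derivative)
qed

context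
  fixes d p
  assumes dp: "d \<in> A" "p \<in> fst d"
begin

lemma from_to_chart: "from_chart A d p (to_chart A d p v) = v"
  unfolding from_chart_def to_chart_def by (intro transition_inverse chart_at_mem dp)

lemma to_from_chart: "to_chart A d p (from_chart A d p v) = v"
  unfolding from_chart_def to_chart_def by (intro transition_inverse chart_at_mem dp)

lemma linear_to_chart: "linear (to_chart A d p)"
  unfolding to_chart_def
  by (rule has_derivative_linear[OF transition_has_derivative[OF chart_at_mem(1) dp(1) chart_at_mem(2) dp(2)]])

lemma linear_from_chart: "linear (from_chart A d p)"
  unfolding from_chart_def
  by (rule has_derivative_linear[OF transition_has_derivative[OF dp(1) chart_at_mem(1) dp(2) chart_at_mem(2)]])

end

text \<open>The transition from a chart to itself is the identity near \<open>p\<close>. Hence chart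
  formulas evaluated at \<open>p\<close> in the selected chart speak directly of the
  vectors.\<close>

lemma to_chart_at: "to_chart A (chart_at A p) p v = v"
proof -
  let ?c = "chart_at A p"
  have "((\<lambda>x. x) has_derivative (\<lambda>v. v)) (at (snd ?c p))"
    by simp
  then have "(snd ?c \<circ> chart_inv ?c has_derivative (\<lambda>v. v)) (at (snd ?c p))"
    by (rule has_derivative_transform_within_open[where s = "snd ?c ` (fst ?c \<inter> UNIV)"])
      (use open_chart_image[OF chart_at_mem(1) open_UNIV] in \<open>auto simp: chart_at_mem chart_inv_chart\<close>)
  from frechet_derivative_at[OF this] show ?thesis
    unfolding to_chart_def by (rule fun_cong[symmetric])
qed

lemma from_chart_at: "from_chart A (chart_at A p) p v = v"
  using from_to_chart[OF chart_at_mem, of p v] unfolding to_chart_at .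

end

section \<open>Non-degenerate symmetric bilinear forms\<close>

lemma subspace_set_plus: "subspace X \<Longrightarrow> subspace Y \<Longrightarrow> subspace (X + Y)"
proof -
  have "X + Y = {x + y |x y. x \<in> X \<and> y \<in> Y}"
    by (auto simp: set_plus_def)
  then show "subspace X \<Longrightarrow> subspace Y \<Longrightarrow> subspace (X + Y)"
    using subspace_sums[of X Y] by simp
qed

lemma subset_set_plus:
  assumes "subspace X" "subspace Y"
  shows "X \<subseteq> X + Y" "Y \<subseteq> X + Y"
proof -
  show "X \<subseteq> X + Y"
    using set_plus_intro[OF _ subspace_0[OF assms(2)], of _ X] by auto
  show "Y \<subseteq> X + Y"
    using set_plus_intro[OF subspace_0[OF assms(1)], of _ Y] by auto
qed

locale sym_form =
  fixes b :: "'v::euclidean_space \<Rightarrow> 'v \<Rightarrow> real"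
  assumes bilinear: "bilinear b" and sym: "b x y = b y x"
begin

lemmas form_simps =
  bilinear_ladd[OF bilinear] bilinear_radd[OF bilinear] bilinear_lsub[OF bilinear]
  bilinear_rsub[OF bilinear] bilinear_lmul[OF bilinear] bilinear_rmul[OF bilinear]
  bilinear_lneg[OF bilinear] bilinear_rneg[OF bilinear]
  bilinear_lzero[OF bilinear] bilinear_rzero[OF bilinear]

lemma linear_form: "linear (b x)" "linear (\<lambda>x. b x y)"
  using bilinear by (auto simp: bilinear_def)

lemma form_sum_left: "b (\<Sum>i\<in>K. f i) y = (\<Sum>i\<in>K. b (f i) y)"
  using linear_sum[OF linear_form(2)] .

lemma subspace_perp: "subspace (perp b E)"
  by (auto simp: subspace_def perp_def form_simps)

lemma polarization: "2 * b x y = b (x + y) (x + y) - b x x - b y y"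
  using sym[of x y] by (simp add: form_simps)

lemma perp_spanI: "(\<And>x. x \<in> K \<Longrightarrow> b v x = 0) \<Longrightarrow> x \<in> span K \<Longrightarrow> b v x = 0"
  using linear_eq_0_on_span[OF linear_form(1)] by blast

lemma orthonormal_expansion:
  assumes "finite K" "pairwise (\<lambda>x y. b x y = 0) K" "\<forall>e\<in>K. b e e = 1 \<or> b e e = -1" "e \<in> K"
  shows "b (\<Sum>x\<in>K. c x *\<^sub>R x) e = c e * b e e"
proof -
  have "(\<Sum>x\<in>K - {e}. c x * b x e) = 0"
    using assms by (intro sum.neutral) (auto simp: pairwise_def)
  then show ?thesis
    using sum.remove[OF assms(1,4), of "\<lambda>x. c x * b x e"] by (simp add: form_sum_left form_simps)
qed

text \<open>An indefinite form has null vectors, so Gram-Schmidt cannot start from an arbitrary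
  basis. The induction splits off a vector with \<open>b x x \<noteq> 0\<close>, whose orthogonal
  complement in \<open>E\<close> is again non-degenerate.\<close>

lemma orthonormal_basis_exists:
  assumes "subspace E" "nondegenerate_on b E"
  shows "\<exists>K. orthonormal_basis b E K"
  using assms
proof (induction "dim E" arbitrary: E rule: less_induct)
  case less
  show ?case
  proof (cases "\<forall>x\<in>E. b x x = 0")
    \<comment> \<open>If every vector is null, polarization makes the form zero on \<open>E\<close>,
      and non-degeneracy leaves only \<open>E = {0}\<close>.\<close>
    case True
    have "b x y = 0" if "x \<in> E" "y \<in> E" for x y
      using polarization[of x y] True that less.prems(1) by (simp add: subspace_add)
    then have "E = {0}"
      using less.prems subspace_0 by (fastforce simp: nondegenerate_on_def)
    then have "orthonormal_basis b E {}"
      by (auto simp: orthonormal_basis_def independent_empty)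
    then show ?thesis by blast
  next
    case False
    then obtain x where x: "x \<in> E" "b x x \<noteq> 0" by blast
    define e where "e = (1 / sqrt \<bar>b x x\<bar>) *\<^sub>R x"
    have eE: "e \<in> E"
      using x less.prems(1) by (simp add: e_def subspace_scale)
    have "b e e = b x x / \<bar>b x x\<bar>"
      by (simp add: e_def form_simps)
    then have ee: "b e e = 1 \<or> b e e = -1"
      using x by (cases "b x x > 0") auto
    \<comment> \<open>The sign \<open>b e e\<close> is its own inverse; hence the coefficient
      \<open>b e e * b v e\<close> of the projection to \<open>e\<close> used in
      \<open>split\<close>.\<close>
    then have ee2: "b e e * b e e = 1" by auto
    define F where "F = E \<inter> perp b {e}"
    have subF: "subspace F"
      unfolding F_def using less.prems(1) subspace_perp by (rule subspace_inter)
    have split: "v - (b e e * b v e) *\<^sub>R e \<in> F" if "v \<in> E" for v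
      using that eE less.prems(1) ee2 unfolding F_def perp_def
      by (auto simp: form_simps subspace_diff subspace_scale algebra_simps)
    have "e \<notin> F"
      using ee by (auto simp: F_def perp_def)
    then have "F \<subset> E"
      using eE by (auto simp: F_def)
    then have "dim F < dim E"
      using less.prems(1) subF by (metis dim_psubset span_eq_iff)
    moreover have "nondegenerate_on b F"
      unfolding nondegenerate_on_def
    proof (intro ballI impI)
      fix v assume v: "v \<in> F" "\<forall>y\<in>F. b v y = 0"
      have "b v y = 0" if "y \<in> E" for y
      proof -
        have "b v (y - (b e e * b y e) *\<^sub>R e) = 0"
          using v(2) split[OF that] by blast
        moreover have "b v e = 0"
          using v(1) by (simp add: F_def perp_def)
        ultimately show ?thesis
          by (simp add: form_simps)
      qed
      then show "v = 0"
        using v(1) less.prems(2) by (auto simp: nondegenerate_on_def F_def)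
    qed
    ultimately obtain K where K: "orthonormal_basis b F K"
      using less.hyps subF by blast
    have KF: "K \<subseteq> F"
      using K span_superset by (force simp: orthonormal_basis_def)
    have "span (insert e K) = E"
    proof
      show "span (insert e K) \<subseteq> E"
        using KF eE less.prems(1) by (intro span_minimal) (auto simp: F_def)
      show "E \<subseteq> span (insert e K)"
        using split K by (auto simp: span_insert orthonormal_basis_def)
    qed
    moreover have "independent (insert e K)"
      using K \<open>e \<notin> F\<close> by (auto simp: independent_insert orthonormal_basis_def)
    moreover have "pairwise (\<lambda>x y. b x y = 0) (insert e K)"
      using K KF sym by (auto simp: orthonormal_basis_def pairwise_insert F_def perp_def)
    ultimately have "orthonormal_basis b E (insert e K)"
      using K ee by (auto simp: orthonormal_basis_def)
    then show ?thesis by blast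
  qed
qed

text \<open>Orthogonal projection: an orthonormal basis of \<open>E\<close> yields the component in
  \<open>E\<close>, where the sign \<open>b e e\<close> in the coefficient compensates the one
  produced by \<open>orthonormal_expansion\<close>.\<close>

lemma nondegenerate_complement:
  assumes "subspace E" "nondegenerate_on b E"
  shows "E + perp b E = UNIV"
proof -
  obtain K where K: "orthonormal_basis b E K"
    using orthonormal_basis_exists[OF assms] by blast
  have "v \<in> E + perp b E" for v
  proof -
    let ?w = "\<Sum>e\<in>K. (b e e * b v e) *\<^sub>R e"
    have "b ?w e = b v e" if "e \<in> K" for e
      using K that by (subst orthonormal_expansion) (auto simp: orthonormal_basis_def)
    then have "b (v - ?w) e = 0" if "e \<in> K" for e
      using that by (simp add: form_simps)
    then have "v - ?w \<in> perp b E"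
      using K perp_spanI[of K "v - ?w"] by (simp add: perp_def orthonormal_basis_def)
    moreover have "?w \<in> E"
    proof -
      have "?w \<in> span K"
        by (intro span_sum span_scale span_base)
      then show ?thesis
        using K by (simp add: orthonormal_basis_def)
    qed
    ultimately show ?thesis
      using set_plus_intro[of ?w E "v - ?w" "perp b E"] by simp
  qed
  then show ?thesis by blast
qed

text \<open>Each term is \<open>b e e * b e e = 1\<close> times \<open>H\<close>, so every
  orthonormal basis gives the same value and the choice inside \<open>trace_on\<close> is harmless.
  The sum involves only the diagonal of \<open>F\<close>, hence the form of the hypothesis.\<close>

lemma trace_on_eq:
  assumes "subspace E" "nondegenerate_on b E" and "\<And>x. x \<in> E \<Longrightarrow> F x x = b x x *\<^sub>R H"
  shows "trace_on b E F = real (dim E) *\<^sub>R H"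
proof -
  define K where "K = (SOME K. orthonormal_basis b E K)"
  have K: "orthonormal_basis b E K"
    unfolding K_def using someI_ex[OF orthonormal_basis_exists[OF assms(1,2)]] .
  have "b e e *\<^sub>R F e e = H" if "e \<in> K" for e
  proof -
    have "e \<in> span K" "b e e = 1 \<or> b e e = -1"
      using K that unfolding orthonormal_basis_def by (blast intro: span_base)+
    moreover have "span K = E"
      using K unfolding orthonormal_basis_def by blast
    ultimately have "F e e = b e e *\<^sub>R H" "b e e * b e e = 1"
      using assms(3) by auto
    then show ?thesis
      by simp
  qed
  then have "(\<Sum>e\<in>K. b e e *\<^sub>R F e e) = (\<Sum>e\<in>K. H)"
    by (rule sum.cong[OF refl])
  then have "trace_on b E F = real (card K) *\<^sub>R H"
    unfolding trace_on_def Let_def K_def[symmetric] by (simp add: sum_constant_scaleR)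
  moreover have "card K = dim E"
    using K dim_span_eq_card_independent[of K] by (simp add: orthonormal_basis_def)
  ultimately show ?thesis by simp
qed

text \<open>A vector of \<open>Y\<close> orthogonal to \<open>Y\<close> is orthogonal to
  \<open>X\<close> as well, hence to all of \<open>E\<close>. This supplies the non-degeneracy of
  \<open>S_sub\<close>, a summand of the screen transversal bundle.\<close>

lemma nondegenerate_summand:
  assumes "nondegenerate_on b E" "orth_sum b E X Y" "subspace X"
  shows "nondegenerate_on b Y"
  unfolding nondegenerate_on_def
proof (intro ballI impI)
  fix y assume y: "y \<in> Y" "\<forall>z\<in>Y. b y z = 0"
  have E: "E = X + Y"
    using assms(2) by (simp add: orth_sum_def direct_sum_def)
  have orth: "b y x = 0" if "x \<in> X" for x
    using assms(2) y(1) that sym[of y x] by (simp add: orth_sum_def)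
  have "b y v = 0" if v: "v \<in> E" for v
    using v y(2) orth unfolding E by (auto simp: form_simps elim!: set_plus_elim)
  moreover have "y \<in> E"
    using set_plus_intro[OF subspace_0[OF assms(3)] y(1)] E by simp
  ultimately show "y = 0"
    using assms(1) unfolding nondegenerate_on_def by blast
qed

lemma nondegenerate_plus:
  assumes X: "nondegenerate_on b X" "subspace X" and Y: "nondegenerate_on b Y" "subspace Y"
    and orth: "\<And>x y. x \<in> X \<Longrightarrow> y \<in> Y \<Longrightarrow> b x y = 0"
  shows "nondegenerate_on b (X + Y)"
  unfolding nondegenerate_on_def
proof (intro ballI impI)
  fix v assume v: "v \<in> X + Y" "\<forall>w\<in>X + Y. b v w = 0"
  then obtain x y where xy: "x \<in> X" "y \<in> Y" "v = x + y"
    by (auto elim!: set_plus_elim)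
  note sub = subset_set_plus[OF X(2) Y(2)]
  have "b x z = 0" if "z \<in> X" for z
  proof -
    have "b v z = 0"
      using v(2) sub that by blast
    then show ?thesis
      using orth[OF that xy(2)] sym[of y z] by (simp add: xy(3) form_simps)
  qed
  moreover have "b y z = 0" if "z \<in> Y" for z
  proof -
    have "b v z = 0"
      using v(2) sub that by blast
    then show ?thesis
      using orth[OF xy(1) that] by (simp add: xy(3) form_simps)
  qed
  ultimately show "v = 0"
    using X(1) Y(1) xy by (auto simp: nondegenerate_on_def)
qed

text \<open>Riesz representation for an indefinite form. It produces the connection from the Koszul
  formula, which prescribes only inner products.\<close>

lemma representation:
  assumes "nondegenerate_on b UNIV" "linear \<phi>"
  shows "\<exists>z. \<forall>w. b z w = \<phi> w"
proof -
  obtain K where K: "orthonormal_basis b UNIV K"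
    using orthonormal_basis_exists[OF subspace_UNIV assms(1)] by blast
  let ?z = "\<Sum>e\<in>K. (b e e * \<phi> e) *\<^sub>R e"
  have "b ?z e = \<phi> e" if "e \<in> K" for e
    using K that by (subst orthonormal_expansion) (auto simp: orthonormal_basis_def)
  then have "b ?z w = \<phi> w" for w
    using linear_eq_on_span[OF linear_form(1) assms(2), of K] K by (auto simp: orthonormal_basis_def)
  then show ?thesis by blast
qed

lemma nondegenerate_eqI:
  assumes "nondegenerate_on b UNIV" "\<And>w. b x w = b y w"
  shows "x = y"
proof -
  have "\<forall>w. b (x - y) w = 0"
    using assms(2) by (simp add: form_simps)
  then have "x - y = 0"
    using assms(1) unfolding nondegenerate_on_def by blast
  then show ?thesis by simp
qed

text \<open>\<open>D u v w\<close> stands for the derivative of the metric coefficient \<open>b v w\<close> in the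
  direction \<open>u\<close>. The connection is given by the Koszul formula for commuting fields.\<close>

lemma levi_civita_unique_exists:
  assumes nondeg: "nondegenerate_on b UNIV"
    and D_lin: "\<And>v w. linear (\<lambda>u. D u v w)" "\<And>u w. linear (\<lambda>v. D u v w)"
    and D_sym: "\<And>u v w. D u v w = D u w v"
  shows "\<exists>!\<Gamma>. bilinear \<Gamma> \<and> (\<forall>u v. \<Gamma> u v = \<Gamma> v u) \<and>
    (\<forall>u v w. D u v w = b (\<Gamma> u v) w + b v (\<Gamma> u w))"
proof -
  define k where "k u v w = (1/2) *\<^sub>R (D u v w + D v u w - D w u v)" for u v w
  have "linear (\<lambda>w. D u v w)" for u v
    using D_lin(2)[of u v] unfolding D_sym[of u _ v] .
  note lins = D_lin this
  have k_lin: "linear (\<lambda>u. k u v w)" "linear (\<lambda>v. k u v w)" "linear (\<lambda>w. k u v w)" for u v w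
    unfolding k_def by (intro linear_compose_scale_right linear_compose_add linear_compose_sub lins)+
  obtain \<Gamma> where \<Gamma>: "\<And>u v w. b (\<Gamma> u v) w = k u v w"
    using representation[OF nondeg k_lin(3)] by metis
  have "\<Gamma> (u + u') v = \<Gamma> u v + \<Gamma> u' v" "\<Gamma> (c *\<^sub>R u) v = c *\<^sub>R \<Gamma> u v"
    "\<Gamma> v (u + u') = \<Gamma> v u + \<Gamma> v u'" "\<Gamma> v (c *\<^sub>R u) = c *\<^sub>R \<Gamma> v u" for u u' v c
    by (rule nondegenerate_eqI[OF nondeg]; simp add: \<Gamma> form_simps linear_add[OF k_lin(1)]
      linear_scale[OF k_lin(1)] linear_add[OF k_lin(2)] linear_scale[OF k_lin(2)])+
  then have "bilinear \<Gamma>"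
    unfolding bilinear_def by (intro conjI allI linearI)
  moreover have "\<Gamma> u v = \<Gamma> v u" for u v
    by (intro nondegenerate_eqI[OF nondeg]) (simp add: \<Gamma> k_def D_sym[of _ u v])
  moreover have "D u v w = b (\<Gamma> u v) w + b v (\<Gamma> u w)" for u v w
  proof -
    have "b (\<Gamma> u v) w = (D u v w + D v u w - D w u v) / 2"
      "b v (\<Gamma> u w) = (D u w v + D w u v - D v u w) / 2"
      using sym[of v "\<Gamma> u w"] D_sym[of v w u] by (simp_all add: \<Gamma> k_def)
    then show ?thesis
      using D_sym[of u v w] by argo
  qed
  moreover have "\<Delta> = \<Gamma>" if \<Delta>: "\<And>u v. \<Delta> u v = \<Delta> v u" "\<And>u v w. D u v w = b (\<Delta> u v) w + b v (\<Delta> u w)" for \<Delta>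
  proof -
    have D: "D u v w = b (\<Delta> u v) w + b (\<Delta> u w) v" for u v w
      unfolding \<Delta>(2) using sym[of v "\<Delta> u w"] by linarith
    \<comment> \<open>Inserting compatibility into \<open>k\<close> gives six terms; by symmetry of
      \<open>\<Delta>\<close> four of them cancel and the other two are equal.\<close>
    have "b (\<Delta> u v) w = k u v w" for u v w
      unfolding k_def D \<Delta>(1)[of v u] \<Delta>(1)[of w u] \<Delta>(1)[of w v] by simp
    then show ?thesis
      by (intro ext nondegenerate_eqI[OF nondeg]) (simp add: \<Gamma>)
  qed
  ultimately show ?thesis by (intro ex1I[of _ \<Gamma>]) blast+
qed

end

section \<open>Direct sums and projections\<close>

lemma direct_sum_zero: "direct_sum E X Y \<Longrightarrow> x \<in> X \<Longrightarrow> x \<in> Y \<Longrightarrow> x = 0"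
  by (auto simp: direct_sum_def)

text \<open>Two candidates for the component differ by an element of \<open>X\<close> that also lies
  in \<open>Y\<close>, so the definite description denotes.\<close>

lemma proj_along_mem:
  assumes "direct_sum E X Y" "subspace X" "subspace Y" "z \<in> E"
  shows "proj_along X Y z \<in> X" "z - proj_along X Y z \<in> Y"
proof -
  obtain x y where xy: "x \<in> X" "y \<in> Y" "z = x + y"
    using assms(1,4) by (auto simp: direct_sum_def elim!: set_plus_elim)
  have "x' = x" if "x' \<in> X" "z - x' \<in> Y" for x'
  proof -
    have "x' - x \<in> X" "y - (z - x') \<in> Y"
      using that xy(1,2) assms(2,3) by (blast intro: subspace_diff)+
    then show ?thesis
      using direct_sum_zero[OF assms(1), of "x' - x"] by (simp add: xy(3) algebra_simps)
  qed
  then have "\<exists>!x. x \<in> X \<and> z - x \<in> Y"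
    using xy by (intro ex1I[of _ x]) auto
  from theI'[OF this] show "proj_along X Y z \<in> X" "z - proj_along X Y z \<in> Y"
    unfolding proj_along_def by auto
qed

lemma direct_sum_commute: "direct_sum E X Y \<Longrightarrow> direct_sum E Y X"
  by (auto simp: direct_sum_def add.commute)

section \<open>Metric compatibility of the Levi-Civita connection\<close>

lemma bilinear_expansion:
  fixes F :: "'v::euclidean_space \<Rightarrow> 'v \<Rightarrow> real"
  assumes "bilinear F"
  shows "F v w = (\<Sum>i\<in>Basis. \<Sum>j\<in>Basis. (v \<bullet> i) * (w \<bullet> j) * F i j)"
proof -
  have "F v w = F (\<Sum>i\<in>Basis. (v \<bullet> i) *\<^sub>R i) (\<Sum>j\<in>Basis. (w \<bullet> j) *\<^sub>R j)"
    by (simp add: euclidean_representation)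
  then show ?thesis
    unfolding bilinear_sum[OF assms] sum.cartesian_product
    by (simp add: bilinear_lmul[OF assms] bilinear_rmul[OF assms] case_prod_unfold mult_ac)
qed

text \<open>Product rule for a form that varies with the base point. Its derivative is known only
  for fixed arguments \<open>v\<close>, \<open>w\<close>, so everything is expanded in the standard
  basis, where scalar products are differentiated; bilinearity of \<open>D u\<close> reassembles the
  first term.\<close>

lemma has_derivative_bilinear_family:
  fixes G :: "'x::euclidean_space \<Rightarrow> 'v::euclidean_space \<Rightarrow> 'v \<Rightarrow> real" and f :: "'y::euclidean_space \<Rightarrow> 'x"
  assumes S: "open S" "t \<in> S" and G: "\<And>s. s \<in> S \<Longrightarrow> bilinear (G (f s))"
    and D: "bilinear (D (f t))" "\<And>v w. ((\<lambda>x. G x v w) has_derivative (\<lambda>u. D u v w)) (at (f t))"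
      "\<And>u. bilinear (D u)"
    and f: "(f has_derivative f') (at t)"
    and y: "(y has_derivative y') (at t)" and z: "(z has_derivative z') (at t)"
  shows "((\<lambda>s. G (f s) (y s) (z s)) has_derivative
    (\<lambda>u. D (f' u) (y t) (z t) + G (f t) (y' u) (z t) + G (f t) (y t) (z' u))) (at t)"
proof -
  have G': "((\<lambda>s. G (f s) i j) has_derivative (\<lambda>u. D (f' u) i j)) (at t)" for i j
    using has_derivative_compose[OF f D(2)] .
  have "((\<lambda>s. \<Sum>i\<in>Basis. \<Sum>j\<in>Basis. (y s \<bullet> i) * (z s \<bullet> j) * G (f s) i j) has_derivative
      (\<lambda>u. \<Sum>i\<in>Basis. \<Sum>j\<in>Basis. (y t \<bullet> i) * (z t \<bullet> j) * D (f' u) i j +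
        ((y t \<bullet> i) * (z' u \<bullet> j) + (y' u \<bullet> i) * (z t \<bullet> j)) * G (f t) i j)) (at t)"
    by (intro has_derivative_sum has_derivative_mult has_derivative_inner_left y z G')
  moreover have "(\<lambda>u. \<Sum>i\<in>Basis. \<Sum>j\<in>Basis. (y t \<bullet> i) * (z t \<bullet> j) * D (f' u) i j +
        ((y t \<bullet> i) * (z' u \<bullet> j) + (y' u \<bullet> i) * (z t \<bullet> j)) * G (f t) i j) =
      (\<lambda>u. D (f' u) (y t) (z t) + G (f t) (y' u) (z t) + G (f t) (y t) (z' u))"
    by (simp add: bilinear_expansion[OF D(3), of _ "y t" "z t"] bilinear_expansion[OF G[OF S(2)], of "y' _" "z t"]
      bilinear_expansion[OF G[OF S(2)], of "y t" "z' _"]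
      sum.distrib algebra_simps)
  ultimately have "((\<lambda>s. \<Sum>i\<in>Basis. \<Sum>j\<in>Basis. (y s \<bullet> i) * (z s \<bullet> j) * G (f s) i j) has_derivative
      (\<lambda>u. D (f' u) (y t) (z t) + G (f t) (y' u) (z t) + G (f t) (y t) (z' u))) (at t)"
    by simp
  then show ?thesis
    by (rule has_derivative_transform_within_open[OF _ S])
      (simp add: bilinear_expansion[OF G, of _ "y _" "z _"])
qed

context
  fixes Mb :: "('a::{t2_space,second_countable_topology}, 'e::euclidean_space, 'z) semi_riem_scheme"
    and q :: nat
  assumes semi_riem: "semi_riemannian q Mb"
begin

lemma smooth_atlas: "smooth_atlas (atlas Mb)"
  using semi_riem by (simp add: semi_riemannian_def)

lemma sym_form_metric: "sym_form (metric Mb p)"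
  using semi_riem unfolding semi_riemannian_def sym_form_def by blast

lemma nondegenerate_metric: "nondegenerate_on (metric Mb p) UNIV"
  using semi_riem by (simp add: semi_riemannian_def)

section \<open>The metric and the Christoffel coefficients in a chart\<close>

context
  fixes d x
  assumes d: "d \<in> atlas Mb" and x: "x \<in> snd d ` fst d"
begin

lemma chart_inv_mem: "chart_inv d x \<in> fst d"
  using x chart_inv_chart[OF smooth_atlas d] by auto

lemma sym_form_metric_in_chart: "sym_form (metric_in_chart Mb d x)"
proof -
  interpret sym_form "metric Mb (chart_inv d x)" by (rule sym_form_metric)
  note lin = linear_from_chart[OF smooth_atlas d chart_inv_mem]
  show ?thesis
    unfolding sym_form_def bilinear_def metric_in_chart_def Let_def
    by (intro conjI allI linearI sym) (simp_all add: linear_add[OF lin] linear_scale[OF lin] form_simps)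
qed

lemma nondegenerate_metric_in_chart: "nondegenerate_on (metric_in_chart Mb d x) UNIV"
  unfolding nondegenerate_on_def
proof (intro ballI impI)
  let ?p = "chart_inv d x"
  fix u assume u: "\<forall>v\<in>UNIV. metric_in_chart Mb d x u v = 0"
  have "metric Mb ?p (from_chart (atlas Mb) d ?p u) v = 0" for v
    using u[rule_format, of "to_chart (atlas Mb) d ?p v"]
    by (simp add: metric_in_chart_def Let_def from_to_chart[OF smooth_atlas d chart_inv_mem])
  then have "from_chart (atlas Mb) d ?p u = 0"
    using nondegenerate_metric[of ?p] unfolding nondegenerate_on_def by blast
  then show "u = 0"
    using to_from_chart[OF smooth_atlas d chart_inv_mem, of u]
      linear_0[OF linear_to_chart[OF smooth_atlas d chart_inv_mem]] by simp
qed

lemma metric_in_chart_has_derivative: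
  "((\<lambda>y. metric_in_chart Mb d y v w) has_derivative
     frechet_derivative (\<lambda>y. metric_in_chart Mb d y v w) (at x)) (at x)"
  using semi_riem d x by (intro smooth_on_has_derivative[of _ "snd d ` fst d"]) (auto simp: semi_riemannian_def)

end

context
  fixes d x
  assumes d: "d \<in> atlas Mb" and x: "x \<in> snd d ` fst d"
begin

lemma bilinear_dmetric: "bilinear (\<lambda>v w. frechet_derivative (\<lambda>y. metric_in_chart Mb d y v w) (at x) u)"
proof -
  note sf = sym_form_metric_in_chart[OF d]
  have op: "open (snd d ` fst d)"
    using open_chart_image[OF smooth_atlas d open_UNIV] by simp
  let ?D = "\<lambda>v w. frechet_derivative (\<lambda>y. metric_in_chart Mb d y v w) (at x)"
  have "((\<lambda>y. metric_in_chart Mb d y (v + c *\<^sub>R v') w) has_derivative (\<lambda>u. ?D v w u + c * ?D v' w u)) (at x)"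
    for v v' w c
    by (rule has_derivative_transform_within_open[where s = "snd d ` fst d" and
          f = "\<lambda>y. metric_in_chart Mb d y v w + c * metric_in_chart Mb d y v' w"])
      (auto intro!: derivative_intros metric_in_chart_has_derivative d x op simp: sym_form.form_simps[OF sf])
  from frechet_derivative_at[OF this, symmetric]
  have add: "?D (v + c *\<^sub>R v') w u = ?D v w u + c * ?D v' w u" for v v' w c
    by (rule fun_cong)
  have "((\<lambda>y. metric_in_chart Mb d y w v) has_derivative ?D v w) (at x)" for v w
    by (rule has_derivative_transform_within_open[OF metric_in_chart_has_derivative[OF d x] op x])
      (rule sym_form.sym[OF sf])
  from frechet_derivative_at[OF this, symmetric]
  have sym: "?D w v u = ?D v w u" for v w
    by (rule fun_cong)
  \<comment> \<open>The coefficient \<open>-1\<close> in \<open>add\<close> gives the value at zero,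
    after which \<open>add\<close> with first vector zero becomes homogeneity.\<close>
  have "?D 0 w u = 0" for w
    using add[of w "-1" w w] by simp
  then have "linear (\<lambda>v. ?D v w u)" for w
    using add[of _ 1 _ w] add[of 0 _ _ w] by (intro linearI) auto
  then show ?thesis
    unfolding bilinear_def using sym by simp
qed

text \<open>By the Koszul argument exactly one bilinear map satisfies the clauses in
  \<open>christoffel\<close>, so the description has its defining properties; this is the metric
  one.\<close>

lemma christoffel_metric:
  "frechet_derivative (\<lambda>y. metric_in_chart Mb d y v w) (at x) u =
    metric_in_chart Mb d x (christoffel Mb d x u v) w + metric_in_chart Mb d x v (christoffel Mb d x u w)"
proof -
  let ?D = "\<lambda>u v w. frechet_derivative (\<lambda>y. metric_in_chart Mb d y v w) (at x) u"
  have op: "open (snd d ` fst d)"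
    using open_chart_image[OF smooth_atlas d open_UNIV] by simp
  have "((\<lambda>y. metric_in_chart Mb d y w v) has_derivative
      frechet_derivative (\<lambda>y. metric_in_chart Mb d y v w) (at x)) (at x)" for v w
    by (rule has_derivative_transform_within_open[OF metric_in_chart_has_derivative[OF d x] op x])
      (rule sym_form.sym[OF sym_form_metric_in_chart[OF d]])
  from frechet_derivative_at[OF this]
  have "?D u v w = ?D u w v" for u v w
    by (rule fun_cong)
  moreover have "linear (\<lambda>u. ?D u v w)" for v w
    by (rule has_derivative_linear[OF metric_in_chart_has_derivative[OF d x]])
  moreover have "linear (\<lambda>v. ?D u v w)" for u w
    using bilinear_dmetric[of u] by (simp add: bilinear_def)
  ultimately have "\<exists>!\<Gamma>. bilinear \<Gamma> \<and> (\<forall>u v. \<Gamma> u v = \<Gamma> v u) \<and>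
      (\<forall>u v w. ?D u v w = metric_in_chart Mb d x (\<Gamma> u v) w + metric_in_chart Mb d x v (\<Gamma> u w))"
    by (intro sym_form.levi_civita_unique_exists[of _ ?D] sym_form_metric_in_chart
        nondegenerate_metric_in_chart d x)
  from theI'[OF this] show "?D u v w = metric_in_chart Mb d x (christoffel Mb d x u v) w +
      metric_in_chart Mb d x v (christoffel Mb d x u w)"
    unfolding christoffel_def by blast
qed

end

section \<open>Covariant derivatives of fields along a map\<close>

context
  fixes B :: "('b::{t2_space,second_countable_topology}, 'c::euclidean_space) chart set" and f :: "'b \<Rightarrow> 'a"
  assumes B: "smooth_atlas B" and f: "smooth_map B (atlas Mb) f"
begin

lemma open_chart_image_along:
  assumes "c \<in> B" "d \<in> atlas Mb" "open U"
  shows "open (snd c ` (fst c \<inter> U \<inter> f -` fst d))"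
proof -
  have "open (f -` fst d)"
    using f open_chart_domain[OF smooth_atlas assms(2)] by (auto simp: smooth_map_def open_vimage)
  then show ?thesis
    using open_chart_image[OF B assms(1), of "U \<inter> f -` fst d"] assms(3) by (simp add: open_Int Int_assoc)
qed

lemma smooth_field_along_add_scaleR:
  assumes "open U" "smooth_field_along B (atlas Mb) f U Y" "smooth_field_along B (atlas Mb) f U Z"
  shows "smooth_field_along B (atlas Mb) f U (\<lambda>p. Y p + s *\<^sub>R Z p)"
  unfolding smooth_field_along_def
proof (intro ballI)
  fix c d assume cd: "c \<in> B" "d \<in> atlas Mb"
  have lin: "linear (to_chart (atlas Mb) d (f (chart_inv c x)))"
    if "x \<in> snd c ` (fst c \<inter> U \<inter> f -` fst d)" for x
    using that cd by (intro linear_to_chart smooth_atlas) (auto simp: chart_inv_chart[OF B])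
  show "smooth_on (\<lambda>x. to_chart (atlas Mb) d (f (chart_inv c x)) (Y (chart_inv c x) + s *\<^sub>R Z (chart_inv c x)))
      (snd c ` (fst c \<inter> U \<inter> f -` fst d))"
    by (rule smooth_on_cong[OF open_chart_image_along[OF cd assms(1)] smooth_on_add_scaleR
          [OF open_chart_image_along[OF cd assms(1)], of _ _ s]])
      (use assms(2,3) cd in \<open>auto simp: smooth_field_along_def linear_add[OF lin] linear_scale[OF lin]\<close>)
qed

lemma smooth_field_along_zero:
  assumes "open U"
  shows "smooth_field_along B (atlas Mb) f U (\<lambda>p. 0)"
  unfolding smooth_field_along_def
proof (intro ballI)
  fix c d assume cd: "c \<in> B" "d \<in> atlas Mb"
  have lin: "linear (to_chart (atlas Mb) d (f (chart_inv c x)))"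
    if "x \<in> snd c ` (fst c \<inter> U \<inter> f -` fst d)" for x
    using that cd by (intro linear_to_chart smooth_atlas) (auto simp: chart_inv_chart[OF B])
  show "smooth_on (\<lambda>x. to_chart (atlas Mb) d (f (chart_inv c x)) 0) (snd c ` (fst c \<inter> U \<inter> f -` fst d))"
    by (rule smooth_on_cong[OF open_chart_image_along[OF cd assms] smooth_on_zero]) (simp add: linear_0[OF lin])
qed

text \<open>Metric compatibility along \<open>f\<close>. The product rule gives a derivative of the
  metric coefficients and the derivatives of the components of \<open>Y\<close> and
  \<open>Z\<close>; \<open>christoffel_metric\<close> splits the former into the two corrections
  that turn the latter into covariant derivatives.\<close>

lemma metric_along_has_derivative:
  assumes U: "open U" "p \<in> U"
    and Y: "smooth_field_along B (atlas Mb) f U Y" and Z: "smooth_field_along B (atlas Mb) f U Z"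
  defines "c \<equiv> chart_at B p"
  shows "((\<lambda>x. metric Mb (f (chart_inv c x)) (Y (chart_inv c x)) (Z (chart_inv c x))) has_derivative
    (\<lambda>u. metric Mb (f p) (cov_along B Mb f p u Y) (Z p) + metric Mb (f p) (Y p) (cov_along B Mb f p u Z)))
    (at (snd c p))"
proof -
  define d where "d = chart_at (atlas Mb) (f p)"
  define S where "S = snd c ` (fst c \<inter> U \<inter> f -` fst d)"
  define \<phi> where "\<phi> = snd d \<circ> f \<circ> chart_inv c"
  define rep where "rep X x = to_chart (atlas Mb) d (f (chart_inv c x)) (X (chart_inv c x))" for X :: "'b \<Rightarrow> 'e" and x
  have c: "c \<in> B" "p \<in> fst c" and d: "d \<in> atlas Mb" "f p \<in> fst d"
    unfolding c_def d_def using chart_at_mem[OF B] chart_at_mem[OF smooth_atlas] by auto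
  have ci: "chart_inv c (snd c p) = p"
    using chart_inv_chart[OF B c] .
  have di: "chart_inv d (snd d (f p)) = f p"
    using chart_inv_chart[OF smooth_atlas d] .
  have S: "open S" "snd c p \<in> S"
    unfolding S_def using open_chart_image_along[OF c(1) d(1) U(1)] c d U by auto
  have \<phi>S: "chart_inv c s \<in> U" "f (chart_inv c s) \<in> fst d" "\<phi> s = snd d (f (chart_inv c s))" if "s \<in> S" for s
    using that by (auto simp: S_def \<phi>_def chart_inv_chart[OF B c(1)])
  have \<phi>: "(\<phi> has_derivative tangent_map B (atlas Mb) f p) (at (snd c p))"
    unfolding tangent_map_def d_def[symmetric] c_def[symmetric] \<phi>_def
    using f c d by (intro smooth_on_has_derivative[of _ "snd c ` (fst c \<inter> f -` fst d)"]) (auto simp: smooth_map_def)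
  have rep: "(rep X has_derivative frechet_derivative (rep X) (at (snd c p))) (at (snd c p))"
    if "smooth_field_along B (atlas Mb) f U X" for X
    using that c d S(2) unfolding rep_def smooth_field_along_def S_def
    by (intro smooth_on_has_derivative[of _ "snd c ` (fst c \<inter> U \<inter> f -` fst d)"]) auto
  have \<phi>p: "\<phi> (snd c p) = snd d (f p)" "snd d (f p) \<in> snd d ` fst d"
    using \<phi>S(3)[OF S(2)] d by (auto simp: ci)
  \<comment> \<open>The chart \<open>d\<close> is the selected one at \<open>f p\<close>, so at
    \<open>p\<close> itself components and vectors coincide; at nearby points the conversion
    remains.\<close>
  have rep_p: "rep X (snd c p) = X p" for X
    by (simp add: rep_def ci d_def to_chart_at[OF smooth_atlas])
  have Gp: "metric_in_chart Mb d (snd d (f p)) u v = metric Mb (f p) u v" for u v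
    unfolding metric_in_chart_def Let_def di by (simp add: d_def from_chart_at[OF smooth_atlas])
  let ?D = "\<lambda>u v w. frechet_derivative (\<lambda>y. metric_in_chart Mb d y v w) (at (snd d (f p))) u"
  have "((\<lambda>s. metric_in_chart Mb d (\<phi> s) (rep Y s) (rep Z s)) has_derivative
      (\<lambda>u. ?D (tangent_map B (atlas Mb) f p u) (rep Y (snd c p)) (rep Z (snd c p)) +
        metric_in_chart Mb d (\<phi> (snd c p)) (frechet_derivative (rep Y) (at (snd c p)) u) (rep Z (snd c p)) +
        metric_in_chart Mb d (\<phi> (snd c p)) (rep Y (snd c p)) (frechet_derivative (rep Z) (at (snd c p)) u)))
      (at (snd c p))"
  proof (rule has_derivative_bilinear_family[OF S])
    show "bilinear (metric_in_chart Mb d (\<phi> s))" if "s \<in> S" for s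
      using sym_form_metric_in_chart[OF d(1), of "\<phi> s"] \<phi>S[OF that] by (simp add: sym_form_def)
  qed (use \<phi> rep Y Z bilinear_dmetric[OF d(1) \<phi>p(2)] metric_in_chart_has_derivative[OF d(1) \<phi>p(2)] in
      \<open>auto simp: \<phi>p(1)\<close>)
  also have "(\<lambda>u. ?D (tangent_map B (atlas Mb) f p u) (rep Y (snd c p)) (rep Z (snd c p)) +
        metric_in_chart Mb d (\<phi> (snd c p)) (frechet_derivative (rep Y) (at (snd c p)) u) (rep Z (snd c p)) +
        metric_in_chart Mb d (\<phi> (snd c p)) (rep Y (snd c p)) (frechet_derivative (rep Z) (at (snd c p)) u)) =
      (\<lambda>u. metric Mb (f p) (cov_along B Mb f p u Y) (Z p) + metric Mb (f p) (Y p) (cov_along B Mb f p u Z))"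
    unfolding christoffel_metric[OF d(1) \<phi>p(2)] \<phi>p(1) rep_p Gp cov_along_def Let_def
      d_def[symmetric] c_def[symmetric] rep_def[symmetric]
    by (simp add: sym_form.form_simps[OF sym_form_metric] algebra_simps)
  finally show ?thesis
  proof (rule has_derivative_transform_within_open[OF _ S])
    fix s assume s: "s \<in> S"
    show "metric_in_chart Mb d (\<phi> s) (rep Y s) (rep Z s) =
        metric Mb (f (chart_inv c s)) (Y (chart_inv c s)) (Z (chart_inv c s))"
      using \<phi>S[OF s] d(1) by (simp add: metric_in_chart_def Let_def rep_def chart_inv_chart[OF smooth_atlas]
          from_to_chart[OF smooth_atlas])
  qed
qed

text \<open>The inner product is the zero function on the open set \<open>U\<close>, so the two
  terms of its derivative add up to zero.\<close>

lemma cov_along_orthogonal: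
  assumes U: "open U" "p \<in> U"
    and Y: "smooth_field_along B (atlas Mb) f U Y" and Z: "smooth_field_along B (atlas Mb) f U Z"
    and orth: "\<And>y. y \<in> U \<Longrightarrow> metric Mb (f y) (Y y) (Z y) = 0"
  shows "metric Mb (f p) (cov_along B Mb f p u Y) (Z p) = - metric Mb (f p) (Y p) (cov_along B Mb f p u Z)"
proof -
  define c where "c = chart_at B p"
  have c: "c \<in> B" "p \<in> fst c"
    unfolding c_def using chart_at_mem[OF B] by auto
  have "((\<lambda>x. 0) has_derivative
    (\<lambda>u. metric Mb (f p) (cov_along B Mb f p u Y) (Z p) + metric Mb (f p) (Y p) (cov_along B Mb f p u Z)))
    (at (snd c p))"
    by (rule has_derivative_transform_within_open[OF metric_along_has_derivative[OF U Y Z, folded c_def]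
          open_chart_image[OF B c(1) U(1)]])
      (use U(2) c orth in \<open>auto simp: chart_inv_chart[OF B]\<close>)
  from fun_cong[OF has_derivative_unique[OF this has_derivative_const], of u] show ?thesis
    by simp
qed

end
end

section \<open>Lightlike submanifolds\<close>

text \<open>\<open>totally_umbilical\<close> hides its field behind an existential quantifier; as a
  parameter, one and the same \<open>H\<close> can be fixed for all the lemmas below.\<close>

definition curvature_field ::
  "('a, 'e::euclidean_space) almost_hermitian \<Rightarrow>
   ('b::topological_space, 'c::euclidean_space, 'a, 'e, 'z) lightlike_scheme \<Rightarrow> ('b \<Rightarrow> 'e) \<Rightarrow> bool" where
  "curvature_field Mb M H \<longleftrightarrow> H \<in> sections Mb M UNIV (tr_bundle M) \<and>
     (\<forall>U X Y p. open U \<and> p \<in> U \<and> X \<in> sections Mb M U (TM Mb M) \<and> Y \<in> sections Mb M U (TM Mb M) \<longrightarrow>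
       sff Mb M p (X p) Y = met Mb M p (X p) (Y p) *\<^sub>R H p)"

lemma totally_umbilical_iff: "totally_umbilical Mb M \<longleftrightarrow> (\<exists>H. curvature_field Mb M H)"
  unfolding totally_umbilical_def curvature_field_def Bex_def ..

lemma local_frame_subspace: "local_frame Mb M U k e E \<Longrightarrow> p \<in> U \<Longrightarrow> subspace (E p)"
  unfolding local_frame_def using subspace_span[of "(\<lambda>i. e i p) ` {..<k}"] by simp

lemma vector_bundle_subspace: "vector_bundle Mb M k E \<Longrightarrow> subspace (E p)"
  unfolding vector_bundle_def using local_frame_subspace by blast

lemma subbundle_subspace: "subbundle Mb M E F \<Longrightarrow> subspace (E p)"
  unfolding subbundle_def using vector_bundle_subspace by blast

context
  fixes Mb :: "('a::{t2_space,second_countable_topology}, 'e::euclidean_space) almost_hermitian"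
    and M :: "('b::{t2_space,second_countable_topology}, 'c::euclidean_space, 'a, 'e, 'z) lightlike_scheme"
    and q r :: nat
  assumes semi_riem: "semi_riemannian q Mb" and lightlike: "lightlike_submanifold r Mb M"
begin

lemma sym_form_met: "sym_form (met Mb M p)"
  unfolding met_def by (rule sym_form_metric[OF semi_riem])

lemma lightlikeD:
  "submanifold Mb M"
  "subbundle Mb M (screen M) (TM Mb M)"
  "subbundle Mb M (screen_tr M) (TM_perp Mb M)"
  "vector_bundle Mb M r (ltr M)"
  "nondegenerate_on (met Mb M p) (screen M p)"
  "orth_sum (met Mb M p) (TM Mb M p) (screen M p) (Rad Mb M p)"
  "nondegenerate_on (met Mb M p) (screen_tr M p)"
  "direct_sum (perp (met Mb M p) (screen M p + screen_tr M p)) (Rad Mb M p) (ltr M p)"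
proof -
  show "submanifold Mb M" "subbundle Mb M (screen M) (TM Mb M)" "subbundle Mb M (screen_tr M) (TM_perp Mb M)"
    "vector_bundle Mb M r (ltr M)"
    using lightlike by (simp_all add: lightlike_submanifold_def)
  have "\<forall>p. nondegenerate_on (met Mb M p) (screen M p) \<and>
      orth_sum (met Mb M p) (TM Mb M p) (screen M p) (Rad Mb M p) \<and>
      nondegenerate_on (met Mb M p) (screen_tr M p) \<and>
      orth_sum (met Mb M p) (TM_perp Mb M p) (screen_tr M p) (Rad Mb M p) \<and>
      direct_sum (perp (met Mb M p) (screen M p + screen_tr M p)) (Rad Mb M p) (ltr M p)"
    using lightlike unfolding lightlike_submanifold_def by (elim conjE)
  then show "nondegenerate_on (met Mb M p) (screen M p)"
    "orth_sum (met Mb M p) (TM Mb M p) (screen M p) (Rad Mb M p)"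
    "nondegenerate_on (met Mb M p) (screen_tr M p)"
    "direct_sum (perp (met Mb M p) (screen M p + screen_tr M p)) (Rad Mb M p) (ltr M p)"
    by blast+
qed

lemma dual_frames:
  obtains U \<xi> N where "p \<in> U" "local_frame Mb M U r \<xi> (Rad Mb M)" "local_frame Mb M U r N (ltr M)"
    "\<And>y i j. y \<in> U \<Longrightarrow> i < r \<Longrightarrow> j < r \<Longrightarrow> met Mb M y (\<xi> i y) (N j y) = (if i = j then 1 else 0)"
proof -
  have "\<forall>p. \<exists>U \<xi> N. p \<in> U \<and> local_frame Mb M U r \<xi> (Rad Mb M) \<and> local_frame Mb M U r N (ltr M) \<and>
      (\<forall>y\<in>U. \<forall>i<r. \<forall>j<r. met Mb M y (\<xi> i y) (N j y) = (if i = j then 1 else 0) \<and>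
        met Mb M y (N i y) (N j y) = 0)"
    using lightlike unfolding lightlike_submanifold_def by (elim conjE)
  from this[rule_format, of p] show ?thesis
  proof (elim exE conjE)
    fix U \<xi> N
    assume frames: "p \<in> U" "local_frame Mb M U r \<xi> (Rad Mb M)" "local_frame Mb M U r N (ltr M)"
      and dual: "\<forall>y\<in>U. \<forall>i<r. \<forall>j<r. met Mb M y (\<xi> i y) (N j y) = (if i = j then 1 else 0) \<and>
        met Mb M y (N i y) (N j y) = 0"
    show ?thesis
      using dual by (intro that[OF frames]) simp
  qed
qed

lemma subspace_bundles:
  "subspace (screen M p)" "subspace (screen_tr M p)" "subspace (ltr M p)" "subspace (Rad Mb M p)"
  "subspace (TM Mb M p)" "subspace (tr_bundle M p)"
proof -
  show s: "subspace (screen M p)" "subspace (screen_tr M p)" "subspace (ltr M p)"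
    using lightlikeD subbundle_subspace vector_bundle_subspace by blast+
  obtain U \<xi> N where "p \<in> U" "local_frame Mb M U r \<xi> (Rad Mb M)"
    by (rule dual_frames)
  then show R: "subspace (Rad Mb M p)"
    using local_frame_subspace by blast
  show "subspace (TM Mb M p)"
    using lightlikeD(6)[of p] subspace_set_plus[OF s(1) R] by (simp add: orth_sum_def direct_sum_def)
  show "subspace (tr_bundle M p)"
    unfolding tr_bundle_def using subspace_set_plus s by blast
qed

lemma screen_subset: "screen M p \<subseteq> TM Mb M p" "screen_tr M p \<subseteq> TM_perp Mb M p" "Rad Mb M p \<subseteq> TM Mb M p"
  using lightlikeD(2,3) by (auto simp: subbundle_def Rad_def)

lemma TM_perp_orth: "w \<in> TM_perp Mb M p \<Longrightarrow> x \<in> TM Mb M p \<Longrightarrow> met Mb M p w x = 0"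
  by (simp add: TM_perp_def perp_def)

lemma Rad_orth: "\<xi> \<in> Rad Mb M p \<Longrightarrow> x \<in> TM Mb M p \<Longrightarrow> met Mb M p \<xi> x = 0"
  by (simp add: Rad_def TM_perp_orth)

lemma ltr_orth:
  assumes "l \<in> ltr M p"
  shows "v \<in> screen M p \<Longrightarrow> met Mb M p l v = 0" "w \<in> screen_tr M p \<Longrightarrow> met Mb M p l w = 0"
proof -
  have "l \<in> perp (met Mb M p) (screen M p + screen_tr M p)"
    using assms lightlikeD(8)[of p] subset_set_plus(2)[OF subspace_bundles(4,3), of p p]
    unfolding direct_sum_def by blast
  then show "v \<in> screen M p \<Longrightarrow> met Mb M p l v = 0" "w \<in> screen_tr M p \<Longrightarrow> met Mb M p l w = 0"
    using subset_set_plus[OF subspace_bundles(1,2)] unfolding perp_def by blast+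
qed

text \<open>Paired with a screen vector, a covariant derivative shows only its tangent part. Radical
  vectors would not do, since ltr(TM) pairs non-trivially with them.\<close>

lemma tr_orth_screen:
  assumes "t \<in> tr_bundle M p" "y \<in> screen M p"
  shows "met Mb M p t y = 0"
proof -
  interpret sym_form "met Mb M p" by (rule sym_form_met)
  obtain l w where "l \<in> ltr M p" "w \<in> screen_tr M p" "t = l + w"
    using assms(1) by (auto simp: tr_bundle_def elim!: set_plus_elim)
  then show ?thesis
    using ltr_orth(1) TM_perp_orth screen_subset assms(2) by (simp add: form_simps subset_iff)
qed

text \<open>In the frame of ltr(TM) dual to a frame of the radical, the coefficients of
  \<open>l\<close> are its inner products with the radical frame.\<close>

lemma ltr_eq_0I:
  assumes l: "l \<in> ltr M p" and orth: "\<And>\<xi>. \<xi> \<in> Rad Mb M p \<Longrightarrow> met Mb M p l \<xi> = 0"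
  shows "l = 0"
proof -
  interpret sym_form "met Mb M p" by (rule sym_form_met)
  obtain U \<xi> N where frames: "p \<in> U" "local_frame Mb M U r \<xi> (Rad Mb M)" "local_frame Mb M U r N (ltr M)"
    and dual: "\<And>i j. i < r \<Longrightarrow> j < r \<Longrightarrow> met Mb M p (\<xi> i p) (N j p) = (if i = j then 1 else 0)"
    by (rule dual_frames[of p]) blast
  have inj: "inj_on (\<lambda>i. N i p) {..<r}" and span: "span ((\<lambda>i. N i p) ` {..<r}) = ltr M p"
    using frames unfolding local_frame_def by blast+
  have \<xi>: "\<xi> i p \<in> Rad Mb M p" if "i < r" for i
    using frames that unfolding local_frame_def sections_def by blast
  obtain c where "l = (\<Sum>v\<in>(\<lambda>i. N i p) ` {..<r}. c v *\<^sub>R v)"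
    using l span by (auto simp: span_finite)
  then have l_eq: "l = (\<Sum>i<r. c (N i p) *\<^sub>R N i p)"
    using inj by (simp add: sum.reindex)
  have "c (N i p) = 0" if i: "i < r" for i
  proof -
    have "met Mb M p l (\<xi> i p) = (\<Sum>j<r. if i = j then c (N j p) else 0)"
      unfolding l_eq form_sum_left
      by (intro sum.cong refl) (simp add: form_simps sym[of "N _ p"] dual[OF i])
    then show ?thesis
      using orth[OF \<xi>[OF i]] i by simp
  qed
  then show ?thesis
    unfolding l_eq by simp
qed

text \<open>Since ltr(TM) is orthogonal to the screen transversal bundle, testing there isolates the
  component \<open>w\<close>, which vanishes by non-degeneracy. What remains lies in ltr(TM) and is
  detected by the radical.\<close>

lemma tr_eq_0I:
  assumes t: "t \<in> tr_bundle M p" and Rad: "\<And>\<xi>. \<xi> \<in> Rad Mb M p \<Longrightarrow> met Mb M p t \<xi> = 0"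
    and scr: "\<And>w. w \<in> screen_tr M p \<Longrightarrow> met Mb M p t w = 0"
  shows "t = 0"
proof -
  interpret sym_form "met Mb M p" by (rule sym_form_met)
  obtain l w where lw: "l \<in> ltr M p" "w \<in> screen_tr M p" "t = l + w"
    using t by (auto simp: tr_bundle_def elim!: set_plus_elim)
  have "met Mb M p w v = 0" if "v \<in> screen_tr M p" for v
    using scr[OF that] ltr_orth(2)[OF lw(1) that] by (simp add: lw(3) form_simps)
  then have "w = 0"
    using lightlikeD(7)[of p] lw(2) unfolding nondegenerate_on_def by blast
  then show ?thesis
    using ltr_eq_0I[OF lw(1)] Rad by (simp add: lw(3))
qed

text \<open>The sum of the two screens is non-degenerate, so its orthogonal complement, which is the
  radical plus ltr(TM), fills up the ambient space; regrouping gives TM and tr(TM). Directness is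
  what gives the Gauss and Weingarten projections a meaning.\<close>

lemma direct_sum_TM_tr: "direct_sum UNIV (TM Mb M p) (tr_bundle M p)"
proof -
  interpret sym_form "met Mb M p" by (rule sym_form_met)
  have orth: "met Mb M p x y = 0" if "x \<in> screen M p" "y \<in> screen_tr M p" for x y
    using TM_perp_orth[of y p x] screen_subset[of p] that sym[of x y] by auto
  have "UNIV = (screen M p + screen_tr M p) + perp (met Mb M p) (screen M p + screen_tr M p)"
    using nondegenerate_complement[OF subspace_set_plus nondegenerate_plus[OF _ _ _ _ orth]]
      lightlikeD(5,7) subspace_bundles by blast
  also have "\<dots> = TM Mb M p + tr_bundle M p"
    using lightlikeD(6,8)[of p] by (simp add: tr_bundle_def orth_sum_def direct_sum_def add_ac)
  finally have "UNIV = TM Mb M p + tr_bundle M p" .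
  moreover have "v = 0" if v: "v \<in> TM Mb M p" "v \<in> tr_bundle M p" for v
  proof (rule tr_eq_0I[OF v(2)])
    show "met Mb M p v \<xi> = 0" if "\<xi> \<in> Rad Mb M p" for \<xi>
      using Rad_orth[OF that v(1)] sym[of v \<xi>] by simp
    show "met Mb M p v w = 0" if "w \<in> screen_tr M p" for w
      using TM_perp_orth[of w p v] screen_subset that v(1) sym[of v w] by auto
  qed
  ultimately show ?thesis
    using subspace_0[OF subspace_bundles(5)] subspace_0[OF subspace_bundles(6)]
    by (auto simp: direct_sum_def)
qed

lemma direct_sum_ltr_screen_tr: "direct_sum (tr_bundle M p) (screen_tr M p) (ltr M p)"
proof -
  have "v = 0" if "v \<in> screen_tr M p" "v \<in> ltr M p" for v
    using lightlikeD(7)[of p] ltr_orth(2)[OF that(2)] that(1) unfolding nondegenerate_on_def by blast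
  then show ?thesis
    using subspace_0[OF subspace_bundles(2)] subspace_0[OF subspace_bundles(3)]
    by (auto simp: direct_sum_def tr_bundle_def add.commute)
qed

lemma smooth_maps: "smooth_atlas (satlas M)" "smooth_map (satlas M) (atlas Mb) (imm M)"
  using lightlikeD(1) by (auto simp: submanifold_def)

section \<open>Local sections and the Gauss decomposition\<close>

lemma section_restrict:
  assumes "Y \<in> sections Mb M U E" "V \<subseteq> U"
  shows "Y \<in> sections Mb M V E"
proof -
  have "smooth_field_along (satlas M) (atlas Mb) (imm M) V Y"
    unfolding smooth_field_along_def
  proof (intro ballI)
    fix c d assume "c \<in> satlas M" "d \<in> atlas Mb"
    then have "smooth_on (\<lambda>x. to_chart (atlas Mb) d (imm M (chart_inv c x)) (Y (chart_inv c x)))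
        (snd c ` (fst c \<inter> U \<inter> imm M -` fst d))"
      using assms(1) unfolding sections_def smooth_field_along_def by blast
    then show "smooth_on (\<lambda>x. to_chart (atlas Mb) d (imm M (chart_inv c x)) (Y (chart_inv c x)))
        (snd c ` (fst c \<inter> V \<inter> imm M -` fst d))"
      by (rule smooth_on_subset) (use assms(2) in blast)
  qed
  then show ?thesis
    using assms unfolding sections_def by blast
qed

lemma section_inclusions:
  "Y \<in> sections Mb M U (screen M) \<Longrightarrow> Y \<in> sections Mb M U (TM Mb M)"
  "Y \<in> sections Mb M U (Rad Mb M) \<Longrightarrow> Y \<in> sections Mb M U (TM Mb M)"
  "Y \<in> sections Mb M U (Rad Mb M) \<Longrightarrow> Y \<in> sections Mb M U (TM_perp Mb M)"
  "Y \<in> sections Mb M U (screen_tr M) \<Longrightarrow> Y \<in> sections Mb M U (TM_perp Mb M)"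
  unfolding sections_def Rad_def using screen_subset by blast+

lemma section_mem: "Y \<in> sections Mb M U E \<Longrightarrow> p \<in> U \<Longrightarrow> Y p \<in> E p"
  by (simp add: sections_def)

text \<open>Frame fields are combined with constant coefficients. This transfers statements
  quantified over fields to single vectors.\<close>

lemma section_through:
  assumes "subbundle Mb M E F" "y \<in> E p"
  obtains U Y where "open U" "p \<in> U" "Y \<in> sections Mb M U E" "Y p = y"
proof -
  obtain k U e where p: "p \<in> U" and fr: "local_frame Mb M U k e E"
    using assms(1) unfolding subbundle_def vector_bundle_def by blast
  have U: "open U" and e: "\<And>i. i < k \<Longrightarrow> e i \<in> sections Mb M U E" and y: "y \<in> span ((\<lambda>i. e i p) ` {..<k})"
    using fr p assms(2) unfolding local_frame_def by auto
  note sub = subbundle_subspace[OF assms(1)]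
  from y have "\<exists>Y. Y \<in> sections Mb M U E \<and> Y p = y"
  proof (induction rule: span_induct_alt)
    case base
    have "(\<lambda>p. 0) \<in> sections Mb M U E"
      using smooth_field_along_zero[OF semi_riem smooth_maps U] subspace_0[OF sub] by (simp add: sections_def)
    then show ?case by blast
  next
    case (step c x y)
    then obtain i Y where iY: "i < k" "x = e i p" "Y \<in> sections Mb M U E" "Y p = y"
      by blast
    have "(\<lambda>p. Y p + c *\<^sub>R e i p) \<in> sections Mb M U E"
      using smooth_field_along_add_scaleR[OF semi_riem smooth_maps U] iY(3) e[OF iY(1)]
        subspace_add[OF sub] subspace_scale[OF sub] by (auto simp: sections_def)
    then show ?case
      using iY by (auto simp: add.commute)
  qed
  then show ?thesis
    using that U p by blast
qed

lemma nab_bar_orthogonal: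
  assumes "open U" "p \<in> U" "Y \<in> sections Mb M U E" "Z \<in> sections Mb M U F"
    and "\<And>y. y \<in> U \<Longrightarrow> met Mb M y (Y y) (Z y) = 0"
  shows "met Mb M p (nab_bar Mb M p x Y) (Z p) = - met Mb M p (Y p) (nab_bar Mb M p x Z)"
  using cov_along_orthogonal[OF semi_riem smooth_maps assms(1,2)] assms(3-5)
  unfolding nab_bar_def met_def sections_def by blast

lemma nab_sff_mem:
  "nab Mb M p x Y \<in> TM Mb M p" "nab_bar Mb M p x Y - nab Mb M p x Y \<in> tr_bundle M p"
  "sff Mb M p x Y \<in> tr_bundle M p" "nab_bar Mb M p x Y - sff Mb M p x Y \<in> TM Mb M p"
  unfolding nab_def sff_def
  using proj_along_mem[OF direct_sum_TM_tr subspace_bundles(5,6)]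
    proj_along_mem[OF direct_sum_commute[OF direct_sum_TM_tr] subspace_bundles(6,5)] by simp_all

section \<open>Totally umbilical lightlike submanifolds\<close>

context
  fixes H :: "'b \<Rightarrow> 'e"
  assumes curvature: "curvature_field Mb M H"
begin

lemma umb:
  "open U \<Longrightarrow> p \<in> U \<Longrightarrow> X \<in> sections Mb M U (TM Mb M) \<Longrightarrow> Y \<in> sections Mb M U (TM Mb M) \<Longrightarrow>
    sff Mb M p (X p) Y = met Mb M p (X p) (Y p) *\<^sub>R H p"
  by (intro curvature[unfolded curvature_field_def, THEN conjunct2, rule_format, where U = U and X = X] conjI)

lemma H_mem: "H p \<in> tr_bundle M p"
  by (rule section_mem[OF curvature[unfolded curvature_field_def, THEN conjunct1] UNIV_I])

text \<open>Umbilicity is stated for two fields on a common open set; here \<open>x\<close> is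
  extended to a local section and both domains are intersected.\<close>

lemma sff_umbilical:
  assumes "open U" "p \<in> U" "Y \<in> sections Mb M U (TM Mb M)" "x \<in> screen M p"
  shows "sff Mb M p x Y = met Mb M p x (Y p) *\<^sub>R H p"
proof -
  obtain V X where V: "open V" "p \<in> V" "X \<in> sections Mb M V (screen M)" "X p = x"
    using section_through[OF lightlikeD(2) assms(4)] .
  have "X \<in> sections Mb M (U \<inter> V) (TM Mb M)" "Y \<in> sections Mb M (U \<inter> V) (TM Mb M)"
    by (intro section_restrict[OF section_inclusions(1)[OF V(3)]] section_restrict[OF assms(3)] Int_lower1 Int_lower2)+
  from umb[OF open_Int[OF assms(1) V(1)] IntI[OF assms(2) V(2)] this] show ?thesis
    by (simp add: V(4))
qed

text \<open>The extension chosen in \<open>sff_vec\<close> is arbitrary, but the umbilical formula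
  depends only on its value at \<open>p\<close>.\<close>

lemma sff_vec_umbilical:
  assumes "x \<in> screen M p" "y \<in> screen M p"
  shows "sff_vec Mb M p x y = met Mb M p x y *\<^sub>R H p"
proof -
  let ?P = "\<lambda>Y. Y p = y \<and> (\<exists>U. open U \<and> p \<in> U \<and> Y \<in> sections Mb M U (TM Mb M))"
  obtain V Y where V: "open V" "p \<in> V" "Y \<in> sections Mb M V (screen M)" "Y p = y"
    using section_through[OF lightlikeD(2) assms(2)] .
  then have "?P Y"
    using section_inclusions(1) by blast
  then have "?P (SOME Y. ?P Y)"
    by (rule someI[of ?P])
  then obtain U where U: "(SOME Y. ?P Y) p = y" "open U" "p \<in> U" "(SOME Y. ?P Y) \<in> sections Mb M U (TM Mb M)"
    by blast
  show ?thesis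
    unfolding sff_vec_def using sff_umbilical[OF U(2-4) assms(1)] unfolding U(1) .
qed

lemma trace_sff: "trace_on (met Mb M p) (screen M p) (sff_vec Mb M p) = real (dim (screen M p)) *\<^sub>R H p"
  by (intro sym_form.trace_on_eq sym_form_met subspace_bundles(1) lightlikeD(5) sff_vec_umbilical)

lemma minimal_iff: "minimal Mb M \<longleftrightarrow> (\<forall>p. dim (screen M p) = 0 \<or> H p = 0)"
proof -
  have "sff_s Mb M p (X p) Y = 0"
    if U: "open U" "p \<in> U" and X: "X \<in> sections Mb M U (Rad Mb M)" and Y: "Y \<in> sections Mb M U (Rad Mb M)"
    for U X Y p
  proof -
    have "sff Mb M p (X p) Y = met Mb M p (X p) (Y p) *\<^sub>R H p"
      using umb[OF U section_inclusions(2)[OF X] section_inclusions(2)[OF Y]] .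
    also have "met Mb M p (X p) (Y p) = 0"
      using section_mem[OF X U(2)] section_mem[OF Y U(2)] screen_subset(3) by (intro Rad_orth) auto
    finally have "sff_s Mb M p (X p) Y = proj_along (screen_tr M p) (ltr M p) 0"
      by (simp add: sff_s_def)
    \<comment> \<open>The projection of zero lies in the screen transversal bundle and its negative
      in ltr(TM), two spaces that meet only in zero.\<close>
    then have mem: "sff_s Mb M p (X p) Y \<in> screen_tr M p" "- sff_s Mb M p (X p) Y \<in> ltr M p"
      using proj_along_mem[OF direct_sum_ltr_screen_tr subspace_bundles(2,3) subspace_0[OF subspace_bundles(6)]]
      by auto
    then show ?thesis
      using direct_sum_zero[OF direct_sum_ltr_screen_tr mem(1)] subspace_neg[OF subspace_bundles(3) mem(2)] by simp
  qed
  then show ?thesis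
    unfolding minimal_def trace_sff by auto
qed

text \<open>Serves both shape operators, because sections of the radical and of the screen
  transversal bundle are both normal to TM. Once the derivative has moved to a tangent extension
  \<open>Y\<close> of \<open>y\<close>, only its transversal part \<open>sff\<close> pairs with
  \<open>W\<close>; the move causes the minus sign.\<close>

lemma met_nab_bar_perp:
  assumes "open U" "p \<in> U" and W: "W \<in> sections Mb M U (TM_perp Mb M)"
    and "x \<in> screen M p" "y \<in> screen M p"
  shows "met Mb M p (nab_bar Mb M p x W) y = - met Mb M p x y * met Mb M p (H p) (W p)"
proof -
  interpret sym_form "met Mb M p" by (rule sym_form_met)
  obtain V Y where V: "open V" "p \<in> V" "Y \<in> sections Mb M V (screen M)" "Y p = y"
    using section_through[OF lightlikeD(2) assms(5)] .
  have Y: "Y \<in> sections Mb M V (TM Mb M)"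
    using section_inclusions(1)[OF V(3)] .
  have "met Mb M p (nab_bar Mb M p x W) (Y p) = - met Mb M p (W p) (nab_bar Mb M p x Y)"
  proof (rule nab_bar_orthogonal[of "U \<inter> V"])
    show "W \<in> sections Mb M (U \<inter> V) (TM_perp Mb M)" "Y \<in> sections Mb M (U \<inter> V) (TM Mb M)"
      by (intro section_restrict[OF W] section_restrict[OF Y] Int_lower1 Int_lower2)+
    show "met Mb M z (W z) (Y z) = 0" if "z \<in> U \<inter> V" for z
      using that section_mem[OF W] section_mem[OF Y] by (intro TM_perp_orth) auto
  qed (use assms V in auto)
  moreover have "met Mb M p (W p) (nab_bar Mb M p x Y - sff Mb M p x Y) = 0"
    using section_mem[OF W assms(2)] nab_sff_mem(4) by (rule TM_perp_orth)
  ultimately show ?thesis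
    using sff_umbilical[OF V(1,2) Y assms(4)] V(4) sym[of "W p" "H p"] by (simp add: form_simps)
qed

lemma met_shape_W:
  assumes "open U" "p \<in> U" and W: "W \<in> sections Mb M U (screen_tr M)"
    and "x \<in> screen M p" "y \<in> screen M p"
  shows "met Mb M p (shape_W Mb M p W x) y = met Mb M p x y * met Mb M p (H p) (W p)"
proof -
  interpret sym_form "met Mb M p" by (rule sym_form_met)
  have "shape_W Mb M p W x = - nab Mb M p x W"
    by (simp add: shape_W_def nab_def)
  moreover have "met Mb M p (nab_bar Mb M p x W - nab Mb M p x W) y = 0"
    using nab_sff_mem(2) assms(5) by (rule tr_orth_screen)
  ultimately show ?thesis
    using met_nab_bar_perp[OF assms(1,2) section_inclusions(4)[OF W] assms(4,5)]
    by (simp add: form_simps)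
qed

text \<open>Two parts are projected away from the derivative of \<xi>, the transversal and then the
  radical one, and both are orthogonal to \<open>y\<close>.\<close>

lemma met_shape_star:
  assumes "open U" "p \<in> U" and \<xi>: "\<xi> \<in> sections Mb M U (Rad Mb M)"
    and "x \<in> screen M p" "y \<in> screen M p"
  shows "met Mb M p (shape_star Mb M p \<xi> x) y = met Mb M p x y * met Mb M p (H p) (\<xi> p)"
proof -
  interpret sym_form "met Mb M p" by (rule sym_form_met)
  have ds: "direct_sum (TM Mb M p) (screen M p) (Rad Mb M p)"
    using lightlikeD(6)[of p] by (simp add: orth_sum_def)
  have \<xi>': "\<xi> \<in> sections Mb M U (TM_perp Mb M)"
    using section_inclusions(3)[OF \<xi>] .
  have "nab Mb M p x \<xi> + shape_star Mb M p \<xi> x \<in> Rad Mb M p"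
    using proj_along_mem(2)[OF ds subspace_bundles(1,4) nab_sff_mem(1)] by (simp add: shape_star_def)
  then have "met Mb M p (nab Mb M p x \<xi> + shape_star Mb M p \<xi> x) y = 0"
    using Rad_orth assms(5) screen_subset(1) by blast
  moreover have "met Mb M p (nab_bar Mb M p x \<xi> - nab Mb M p x \<xi>) y = 0"
    using nab_sff_mem(2) assms(5) by (rule tr_orth_screen)
  ultimately show ?thesis
    using met_nab_bar_perp[OF assms(1,2) \<xi>' assms(4,5)] by (simp add: form_simps)
qed

end
end

section \<open>STCR lightlike submanifolds\<close>

text \<open>J(S) lies in D', because S lies in J(D') and J squares to -I; so it is contained in the
  screen and orthogonal to D0. It is non-degenerate because S is an orthogonal summand of the
  non-degenerate screen transversal bundle and J is an isometry.\<close>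

lemma D0_JS_properties:
  fixes Mb :: "('a::{t2_space,second_countable_topology}, 'e::euclidean_space) almost_hermitian"
    and M :: "('b::{t2_space,second_countable_topology}, 'c::euclidean_space, 'a, 'e) stcr"
  assumes Kaehler: "indefinite_Kaehler q Mb" and STCR: "STCR_lightlike r Mb M"
  shows "D0_JS Mb M p \<subseteq> screen M p" "subspace (D0_JS Mb M p)"
    "nondegenerate_on (met Mb M p) (D0_JS Mb M p)"
proof -
  let ?J = "Jb Mb M p" and ?g = "met Mb M p"
  have semi: "semi_riemannian q Mb" and light: "lightlike_submanifold r Mb M"
    and lin: "linear ?J" and JJ: "\<And>u. ?J (?J u) = - u" and iso: "\<And>u v. ?g (?J u) (?J v) = ?g u v"
    using Kaehler STCR by (auto simp: indefinite_Kaehler_def STCR_lightlike_def Jb_def met_def)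
  interpret sym_form ?g by (rule sym_form_met[OF semi light])
  have sub: "subspace (D1 M p)" "subspace (D2 M p)" "subspace (D0 M p)" "subspace (D' M p)"
    "subspace (L1 M p)" "subspace (L2 M p)" "subspace (S_sub M p)"
    using STCR subbundle_subspace unfolding STCR_lightlike_def by blast+
  have screen: "orth_sum ?g (screen M p) (?J ` D1 M p + D' M p) (D0 M p)"
    and JD': "orth_sum ?g (?J ` D' M p) (L1 M p) (S_sub M p)"
    and D0: "nondegenerate_on ?g (D0 M p)"
    and screen_tr: "orth_sum ?g (screen_tr M p) (?J ` D2 M p + ?J ` L2 M p) (S_sub M p)"
    using STCR unfolding STCR_lightlike_def Let_def by blast+
  note subJ = linear_subspace_image[OF lin]
  have S: "nondegenerate_on ?g (S_sub M p)"
    using nondegenerate_summand[OF lightlikeD(7)[OF semi light] screen_tr] subspace_set_plus subJ sub by blast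
  have JS: "nondegenerate_on ?g (?J ` S_sub M p)"
    unfolding nondegenerate_on_def
  proof (intro ballI impI)
    fix x assume x: "x \<in> ?J ` S_sub M p" "\<forall>y\<in>?J ` S_sub M p. ?g x y = 0"
    then obtain s where s: "s \<in> S_sub M p" "x = ?J s" by blast
    then have "\<forall>t\<in>S_sub M p. ?g s t = 0"
      using x(2) iso by auto
    then have "s = 0"
      using S s(1) unfolding nondegenerate_on_def by blast
    then show "x = 0"
      using s(2) linear_0[OF lin] by simp
  qed
  have JS_D': "?J ` S_sub M p \<subseteq> D' M p"
  proof
    fix x assume "x \<in> ?J ` S_sub M p"
    then obtain s where s: "s \<in> S_sub M p" "x = ?J s" by blast
    then have "s \<in> ?J ` D' M p"
      using JD' subset_set_plus(2)[OF sub(5,7)] unfolding orth_sum_def direct_sum_def by blast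
    then show "x \<in> D' M p"
      using s(2) JJ subspace_neg[OF sub(4)] by auto
  qed
  then have JS_sub: "?J ` S_sub M p \<subseteq> ?J ` D1 M p + D' M p"
    using subset_set_plus(2)[OF subJ[OF sub(1)] sub(4)] by blast
  have "D0 M p + ?J ` S_sub M p \<subseteq> D0 M p + (?J ` D1 M p + D' M p)"
    by (intro set_plus_mono2 order_refl JS_sub)
  then show "D0_JS Mb M p \<subseteq> screen M p"
    using screen by (simp add: D0_JS_def orth_sum_def direct_sum_def add.commute)
  show "subspace (D0_JS Mb M p)"
    unfolding D0_JS_def by (intro subspace_set_plus subJ sub)
  have "?g x y = 0" if "x \<in> D0 M p" "y \<in> ?J ` S_sub M p" for x y
    using that JS_sub screen sym[of x y] unfolding orth_sum_def by auto
  then show "nondegenerate_on ?g (D0_JS Mb M p)"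
    unfolding D0_JS_def by (intro nondegenerate_plus D0 JS subJ sub)
qed

theorem theorem5p1:
  fixes Mb :: "('a::{t2_space,second_countable_topology}, 'e::euclidean_space) almost_hermitian"
    and M :: "('b::{t2_space,second_countable_topology}, 'c::euclidean_space, 'a, 'e) stcr"
    and U :: "'i \<Rightarrow> 'b set" and \<xi> W :: "'i \<Rightarrow> nat \<Rightarrow> 'b \<Rightarrow> 'e"
    and q m n r :: nat
  assumes Kaehler: "indefinite_Kaehler q Mb"
    and STCR: "STCR_lightlike r Mb M"
    and umbilical: "totally_umbilical Mb M"
    and "DIM('c) = m" and "DIM('e) = m + n"
    and trace_nonvacuous: "\<forall>p. D0_JS Mb M p = {0} \<longrightarrow> screen M p = {0}"
    and cover: "(\<Union>a. U a) = UNIV"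
    and "\<forall>a. local_frame Mb M (U a) r (\<xi> a) (Rad Mb M)"
    and "\<forall>a. local_frame Mb M (U a) (n - r) (W a) (screen_tr M)"
  shows "minimal Mb M \<longleftrightarrow>
    (\<forall>a. \<forall>p\<in>U a.
       (\<forall>j<n - r. trace_D0_JS Mb M p (shape_W Mb M p (W a j)) = 0) \<and>
       (\<forall>k<r. trace_D0_JS Mb M p (shape_star Mb M p (\<xi> a k)) = 0))"
proof -
  have semi: "semi_riemannian q Mb" and light: "lightlike_submanifold r Mb M"
    using Kaehler STCR by (auto simp: indefinite_Kaehler_def STCR_lightlike_def)
  obtain H where H: "curvature_field Mb M H"
    using umbilical unfolding totally_umbilical_iff by blast
  note frames = assms(8,9)[rule_format]
  note D = D0_JS_properties[OF Kaehler STCR]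
  have trace: "trace_D0_JS Mb M p A = real (dim (D0_JS Mb M p)) * h"
    if "\<And>x. x \<in> screen M p \<Longrightarrow> met Mb M p (A x) x = met Mb M p x x * h" for p A h
    unfolding trace_D0_JS_def
    \<comment> \<open>The number \<open>h\<close> takes the place of the vector \<open>H\<close> in
      \<open>trace_on_eq\<close>, with the reals as target space.\<close>
    unfolding real_scaleR_def[symmetric]
    by (intro sym_form.trace_on_eq[OF sym_form_met[OF semi light] D(2,3)])
      (simp add: that subsetD[OF D(1)])
  have open_U: "open (U a)" for a
    using frames(1) by (simp add: local_frame_def)
  have trace_W: "trace_D0_JS Mb M p (shape_W Mb M p (W a j)) = real (dim (D0_JS Mb M p)) * met Mb M p (H p) (W a j p)"
    if "p \<in> U a" "j < n - r" for p a j
  proof -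
    have "W a j \<in> sections Mb M (U a) (screen_tr M)"
      using frames(2)[of a] that(2) unfolding local_frame_def by blast
    from met_shape_W[OF semi light H open_U that(1) this] show ?thesis
      by (intro trace)
  qed
  have trace_\<xi>: "trace_D0_JS Mb M p (shape_star Mb M p (\<xi> a k)) = real (dim (D0_JS Mb M p)) * met Mb M p (H p) (\<xi> a k p)"
    if "p \<in> U a" "k < r" for p a k
  proof -
    have "\<xi> a k \<in> sections Mb M (U a) (Rad Mb M)"
      using frames(1)[of a] that(2) unfolding local_frame_def by blast
    from met_shape_star[OF semi light H open_U that(1) this] show ?thesis
      by (intro trace)
  qed
  \<comment> \<open>One direction is the inclusion in the screen; the other is
    \<open>trace_nonvacuous\<close>, which keeps the dimension factor of the traces non-zero
    wherever the screen is non-zero.\<close>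
  have dims: "dim (D0_JS Mb M p) = 0 \<longleftrightarrow> dim (screen M p) = 0" for p
    using trace_nonvacuous D(1,2)[of p] subspace_0[OF D(2)[of p]] by (auto simp: dim_eq_0)
  have H_eq_0: "H p = 0" if p: "p \<in> U a" and W: "\<And>j. j < n - r \<Longrightarrow> met Mb M p (H p) (W a j p) = 0"
    and \<xi>: "\<And>k. k < r \<Longrightarrow> met Mb M p (H p) (\<xi> a k p) = 0" for a p
  proof (rule tr_eq_0I[OF semi light H_mem[OF semi light H]])
    have span: "span ((\<lambda>k. \<xi> a k p) ` {..<r}) = Rad Mb M p" "span ((\<lambda>j. W a j p) ` {..<n - r}) = screen_tr M p"
      using frames[of a] p unfolding local_frame_def by blast+
    note perp = sym_form.perp_spanI[OF sym_form_met[OF semi light]]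
    show "met Mb M p (H p) x = 0" if "x \<in> Rad Mb M p" for x
      by (rule perp[OF _ that[folded span(1)]]) (use \<xi> in blast)
    show "met Mb M p (H p) w = 0" if "w \<in> screen_tr M p" for w
      by (rule perp[OF _ that[folded span(2)]]) (use W in blast)
  qed
  show ?thesis
    unfolding minimal_iff[OF semi light H]
  proof
    assume min: "\<forall>p. dim (screen M p) = 0 \<or> H p = 0"
    have "real (dim (D0_JS Mb M p)) * met Mb M p (H p) v = 0" for p v
      using min[rule_format, of p] dims[of p] sym_form.form_simps(9)[OF sym_form_met[OF semi light]] by auto
    then show "\<forall>a. \<forall>p\<in>U a. (\<forall>j<n - r. trace_D0_JS Mb M p (shape_W Mb M p (W a j)) = 0) \<and>
        (\<forall>k<r. trace_D0_JS Mb M p (shape_star Mb M p (\<xi> a k)) = 0)"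
      using trace_W trace_\<xi> by simp
  next
    assume tr: "\<forall>a. \<forall>p\<in>U a. (\<forall>j<n - r. trace_D0_JS Mb M p (shape_W Mb M p (W a j)) = 0) \<and>
        (\<forall>k<r. trace_D0_JS Mb M p (shape_star Mb M p (\<xi> a k)) = 0)"
    show "\<forall>p. dim (screen M p) = 0 \<or> H p = 0"
    proof (intro allI disjCI)
      fix p assume "H p \<noteq> 0"
      obtain a where a: "p \<in> U a"
        using cover by blast
      show "dim (screen M p) = 0"
      proof (rule ccontr)
        assume "dim (screen M p) \<noteq> 0"
        \<comment> \<open>By \<open>dims\<close> the dimension factor can be cancelled from every
          trace, leaving \<open>H p\<close> orthogonal to both frames.\<close>
        then have "H p = 0"
          using tr a trace_W[OF a] trace_\<xi>[OF a] dims[of p] by (intro H_eq_0[OF a]) auto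
        then show False
          using \<open>H p \<noteq> 0\<close> by simp
      qed
    qed
  qed
qed

end
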